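(* Let $(\tilde z_{k_i})_{i\in I}=((\tilde x_{k_i},\tilde y_{k_i}))_{i\in I}$, $(v_{k_i})_{i\in I}$, $(\varepsilon_{k_i})_{i\in I}$ be the (sub)sequences generated by Algorithm 1, and let $(\tilde z_i^a)_{i\in I}=((\tilde x_i^a,\tilde y_i^a))_{i\in I}$, $(v_i^a)_{i\in I}$, $(\varepsilon_i^a)_{i\in I}$ be the associated ergodic sequences (all defined in the context). Then, for any $i\in I$: (a) [pointwise] there exists $j\in\{1,\dots,i\}$ such that $$v_{k_j}\in\partial_{\varepsilon_{k_j}}\left(\overline{\mathscr L}(\cdot,\tilde y_{k_j})-\overline{\mathscr L}(\tilde x_{k_j},\cdot)\right)(\tilde x_{k_j},\tilde y_{k_j})$$ and $$\|v_{k_j}\|\le\frac{d_0^2}{i\tau(1-\sigma)\eta},\qquad \varepsilon_{k_j}\le\frac{\sigma^2d_0^3}{(i\tau)^{3/2}(1-\sigma^2)^{3/2}2\eta};$$ (b) [pointwise] there exist $j\in\{1,\dots,i\}$ and $(p_j,q_j)\in\mathbb R^n\times\mathbb R^m$ such that $$p_j=\nabla f(\tilde x_{k_j})+\nabla g(\tilde x_{k_j})\tilde y_{k_j},\quad g(\tilde x_{k_j})+q_j\le0,\quad \tilde y_{k_j}\ge0,\quad \langle\tilde y_{k_j},g(\tilde x_{k_j})+q_j\rangle=-\varepsilon_{k_j}$$ and $$\|(p_j,q_j)\|\le\frac{d_0^2}{i\tau(1-\sigma)\eta},\qquad \varepsilon_{k_j}\le\frac{\sigma^2d_0^3}{(i\tau)^{3/2}(1-\sigma^2)^{3/2}2\eta};$$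 (c) [ergodic] $$v_i^a\in\partial_{\varepsilon_i^a}\left(\overline{\mathscr L}(\cdot,\tilde y_i^a)-\overline{\mathscr L}(\tilde x_i^a,\cdot)\right)(\tilde x_i^a,\tilde y_i^a)$$ and $$\|v_i^a\|\le\frac{2d_0^2}{(i\tau)^{3/2}(\sqrt{1-\sigma^2})\eta},\qquad \varepsilon_i^a\le\frac{2d_0^3}{(i\tau)^{3/2}(1-\sigma^2)\eta};$$ (d) [ergodic] there exists $(p_i^a,q_i^a)\in\mathbb R^n\times\mathbb R^m$ such that $$p_i^a\in\partial_{x,\varepsilon_i'}\overline{\mathscr L}(\tilde x_i^a,\tilde y_i^a),\quad g(\tilde x_i^a)+q_i^a\le0,\quad \tilde y_i^a\ge0,\quad \langle\tilde y_i^a,g(\tilde x_i^a)+q_i^a\rangle\ge-\varepsilon_i^a$$ and $$\|(p_i^a,q_i^a)\|\le\frac{2d_0^2}{(i\tau)^{3/2}(\sqrt{1-\sigma^2})\eta},\qquad \varepsilon_i^a\le\frac{2d_0^3}{(i\tau)^{3/2}(1-\sigma^2)\eta},$$ where $\varepsilon_i':=\varepsilon_i^a+\langle\tilde y_i^a,g(\tilde x_i^a)+q_i^a\rangle$.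
   Context: Notation: $\langle\cdot,\cdot\rangle$, $\|\cdot\|$ are Euclidean; for vectors, $(\cdot)_+$, $(\cdot)_-$, $|\cdot|$ and inequalities are componentwise with $t_+=\max\{t,0\}$, $t_-=\max\{-t,0\}$. Problem: $\min f(x)$ s.t. $g(x)\le 0$, with $f:\mathbb R^n\to\mathbb R$, $g=(g_1,\dots,g_m):\mathbb R^n\to\mathbb R^m$. Standing assumptions: (O.1) $f,g_1,\dots,g_m$ are convex and $C^2$; (O.2) the Hessians of $f,g_1,\dots,g_m$ are Lipschitz continuous with constants $L_0,L_1,\dots,L_m$, and $L_i\ne0$ for some $i\ge1$; (O.3) there is $(x,y)\in\mathbb R^n\times\mathbb R^m$ satisfying the KKT conditions $\nabla f(x)+\nabla g(x)y=0$, $g(x)\le0$, $y\ge0$, $\langle y,g(x)\rangle=0$. Here $\nabla g(x)$ is the $n\times m$ matrix with columns $\nabla g_i(x)$. $L_g:=(L_1,\dots,L_m)$. $\mathbf S(x,y):=(\nabla f(x)+\nabla g(x)y,\,-g(x))$. For $\mathring z\in\mathbb R^n\times\mathbb R^m$, $\lambda\in\mathbb R$, $z=(x,y)\in\mathbb R^n\times\mathbb R^m_+$: $\Psi_{\mathbf S,\mathring z,\lambda}(z):=\min_{w\in\mathbb R^m_+}\|\lambda(\mathbf S(z)-(0,w))+z-\mathring z\|^2+2\lambda\langle y,w\rangle$. For $\lambda>0$ and $\theta'\ge0$, $\mathcal N_{\theta'}(\mathring z,\lambda)$ is the set of $(x,y)\in\mathbb R^n\times\mathbb R^m_+$ with $\lambda\left(\frac{L_0+\langle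 L_g,|y|\rangle}{2}+\frac{2\|L_g\|}{3}\rho\right)\rho\le\theta'$, where $\rho=\sqrt{\Psi_{\mathbf S,\mathring z,\lambda}(x,y)}$. For $y\in\mathbb R^m$, $\alpha>0$, $\rho(y,\alpha)$ is the largest root $\rho$ of $\left(\frac{L_0+\langle L_g,|y|\rangle}{2}+\frac{2\|L_g\|}{3}\rho\right)\rho=\alpha$. For $\tilde x\in\mathbb R^n$, $f_{[\tilde x]}$ and $g_{[\tilde x]}=(g_{1,[\tilde x]},\dots,g_{m,[\tilde x]})$ are the second-order Taylor polynomials of $f$ and of the components of $g$ at $\tilde x$. Algorithm 1. Initialization: choose $(x_0,y_0)=(\tilde x_1,\tilde y_1)\in\mathbb R^n\times\mathbb R^m_+$, $0<\sigma<1$, $0<\theta\le1/4$; let $h$ be the positive root of $\theta(1+h')(1+h'(1+1/\sigma))^2=1$ (unknown $h'$) and $\tau=h/(1+h)$; choose $\lambda_1>0$ with $(\tilde x_1,\tilde y_1)\in\mathcal N_{\theta^2}((x_0,y_0),\lambda_1)$. It is assumed that $(\tilde x_1,\tilde y_1)$ does not satisfy the KKT conditions. Iteration $k=1,2,\dots$: write $z_{k-1}=(x_{k-1},y_{k-1})$, $\tilde z_k=(\tilde x_k,\tilde y_k)$, $\rho_k=\rho(\tilde y_k,\theta^2/\lambda_k)$. - If $\rho_k\le\sigma\|\tilde z_k-z_{k-1}\|$: $\lambda_{k+1}=(1-\tau)\lambda_k$, $\tilde z_{k+1}=\tilde z_k$, $x_k=x_{k-1}-\tau\lambda_k[\nabla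 f(\tilde x_k)+\nabla g(\tilde x_k)\tilde y_k]$, $y_k=y_{k-1}+\tau[\lambda_kg(\tilde x_k)+(\lambda_kg(\tilde x_k)+y_{k-1})_-]$. - Otherwise: $\lambda_{k+1}=(1-\tau)^{-1}\lambda_k$, $z_k=z_{k-1}$, and $\tilde z_{k+1}$ is the (unique) solution of $\min_{x\in\mathbb R^n}\max_{y\in\mathbb R^m_+} f_{[\tilde x_k]}(x)+\langle y,g_{[\tilde x_k]}(x)\rangle+\frac{\|x-x_k\|^2-\|y-y_k\|^2}{2\lambda_{k+1}}$. Associated quantities for $k\ge1$: $w_k=(g(\tilde x_k)+\lambda_k^{-1}y_{k-1})_-$, $v_k=\mathbf S(\tilde z_k)-(0,w_k)$, $\varepsilon_k=\langle\tilde y_k,w_k\rangle$. Let $A=\{k\ge1:\rho_k\le\sigma\|\tilde z_k-z_{k-1}\|\}$, $I=\{i\in\mathbb N:1\le i\le\#A\}$, and let $k_i$ be the $i$-th element of $A$ (in increasing order). Ergodic quantities, for $i\in I$: $\Lambda_i=\tau\sum_{j=1}^i\lambda_{k_j}$, $\tilde z_i^a=(\tilde x_i^a,\tilde y_i^a)=\frac1{\Lambda_i}\tau\sum_{j=1}^i\lambda_{k_j}\tilde z_{k_j}$, $v_i^a=\frac1{\Lambda_i}\tau\sum_{j=1}^i\lambda_{k_j}v_{k_j}$, $\varepsilon_i^a=\frac1{\Lambda_i}\tau\sum_{j=1}^i\lambda_{k_j}\left(\varepsilon_{k_j}+\langle\tilde z_{k_j}-\tilde z_i^a,v_{k_j}-v_i^a\rangle\right)$.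 $\mathcal K$ is the set of pairs satisfying the KKT conditions and $d_0$ is the distance from $z_0=(x_0,y_0)$ to $\mathcal K$. Constants: $c:=\frac{L_0+\langle L_g,|y_0|\rangle}{2}+\left[\frac12+\frac{1/2+2\sigma/3}{\sqrt{1-\sigma^2}}\right]d_0\|L_g\|$, $\ \eta:=\frac{\theta^2}{\sigma c}$. $\overline{\mathscr L}(x,y):=f(x)+\langle y,g(x)\rangle$ if $y\ge0$, and $-\infty$ otherwise. For $y\ge0$, $\overline{\mathscr L}(\cdot,y)-\overline{\mathscr L}(x,\cdot)$ is the function $(x',y')\mapsto\overline{\mathscr L}(x',y)-\overline{\mathscr L}(x,y')$ on $\mathbb R^n\times\mathbb R^m$; $\partial_\varepsilon$ ($\varepsilon\ge0$) is the usual $\varepsilon$-subdifferential of convex analysis, and $\partial_{x,\varepsilon'}\overline{\mathscr L}(x,y)$ is the $\varepsilon'$-subdifferential of $\overline{\mathscr L}(\cdot,y)$ at $x$. *)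

theory Defs
  imports "HOL-Analysis.Analysis"
begin

definition grad :: "(real^'n \<Rightarrow> real) \<Rightarrow> real^'n \<Rightarrow> real^'n" where
  "grad f x = (THE D. GDERIV f x :> D)"

text \<open>The Hessian is kept as a bounded linear operator, so that the metric behind its continuity
  and Lipschitz continuity is the one of the operator norm.\<close>

definition hessian :: "(real^'n \<Rightarrow> real) \<Rightarrow> real^'n \<Rightarrow> ((real^'n) \<Rightarrow>\<^sub>L (real^'n))" where
  "hessian f x = Blinfun (frechet_derivative (grad f) (at x))"

definition C2 :: "(real^'n \<Rightarrow> real) \<Rightarrow> bool" where
  "C2 f \<longleftrightarrow> (\<forall>x. f differentiable (at x)) \<and> (\<forall>x. grad f differentiable (at x))
     \<and> continuous_on UNIV (hessian f)"

definition taylor2 :: "(real^'n \<Rightarrow> real) \<Rightarrow> real^'n \<Rightarrow> real^'n \<Rightarrow> real" where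
  "taylor2 f a x = f a + grad f a \<bullet> (x - a) + ((x - a) \<bullet> blinfun_apply (hessian f a) (x - a)) / 2"

definition taylor2_vec :: "(real^'n \<Rightarrow> real^'m) \<Rightarrow> real^'n \<Rightarrow> real^'n \<Rightarrow> real^'m" where
  "taylor2_vec g a x = (\<chi> i. taylor2 (\<lambda>u. g u $ i) a x)"

text \<open>The columns are the gradients of the components, so this is the transpose of the Jacobian.\<close>

definition gradmat :: "(real^'n \<Rightarrow> real^'m) \<Rightarrow> real^'n \<Rightarrow> real^'m^'n" where
  "gradmat g x = (\<chi> r c. grad (\<lambda>u. g u $ c) x $ r)"

definition neg_part :: "real^'m \<Rightarrow> real^'m" where
  "neg_part y = (\<chi> i. max (- (y $ i)) 0)"

definition KKT :: "(real^'n \<Rightarrow> real) \<Rightarrow> (real^'n \<Rightarrow> real^'m) \<Rightarrow> ((real^'n) \<times> (real^'m)) set" where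
  "KKT f g = {(x, y). grad f x + gradmat g x *v y = 0 \<and> g x \<le> 0 \<and> 0 \<le> y \<and> y \<bullet> g x = 0}"

definition standing_assumptions ::
    "(real^'n \<Rightarrow> real) \<Rightarrow> (real^'n \<Rightarrow> real^'m) \<Rightarrow> real \<Rightarrow> real^'m \<Rightarrow> bool" where
  "standing_assumptions f g L0 Lg \<longleftrightarrow>
     convex_on UNIV f \<and> C2 f \<and> (\<forall>i. convex_on UNIV (\<lambda>x. g x $ i) \<and> C2 (\<lambda>x. g x $ i)) \<and>
     L0-lipschitz_on UNIV (hessian f) \<and> (\<forall>i. (Lg $ i)-lipschitz_on UNIV (hessian (\<lambda>x. g x $ i))) \<and>
     (\<exists>i. Lg $ i \<noteq> 0) \<and> KKT f g \<noteq> {}"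

definition opS :: "(real^'n \<Rightarrow> real) \<Rightarrow> (real^'n \<Rightarrow> real^'m) \<Rightarrow> (real^'n) \<times> (real^'m) \<Rightarrow> (real^'n) \<times> (real^'m)" where
  "opS f g = (\<lambda>(x, y). (grad f x + gradmat g x *v y, - g x))"

text \<open>The infimum is a minimum: in \<open>w\<close> the objective is constant for \<open>\<lambda> = 0\<close> and a strictly
  convex quadratic otherwise.\<close>

definition Psi :: "(real^'n \<Rightarrow> real) \<Rightarrow> (real^'n \<Rightarrow> real^'m) \<Rightarrow> (real^'n) \<times> (real^'m) \<Rightarrow> real
    \<Rightarrow> (real^'n) \<times> (real^'m) \<Rightarrow> real" where
  "Psi f g z0 lam z =
     (INF w\<in>{0..}. (norm (lam *\<^sub>R (opS f g z - (0, w)) + z - z0))\<^sup>2 + 2 * lam * (snd z \<bullet> w))"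

definition quad_bound :: "real \<Rightarrow> real^'m \<Rightarrow> real^'m \<Rightarrow> real \<Rightarrow> real" where
  "quad_bound L0 Lg y \<rho> = ((L0 + Lg \<bullet> \<bar>y\<bar>) / 2 + (2 * norm Lg / 3) * \<rho>) * \<rho>"

definition nbhd :: "(real^'n \<Rightarrow> real) \<Rightarrow> (real^'n \<Rightarrow> real^'m) \<Rightarrow> real \<Rightarrow> real^'m \<Rightarrow> real
    \<Rightarrow> (real^'n) \<times> (real^'m) \<Rightarrow> real \<Rightarrow> ((real^'n) \<times> (real^'m)) set" where
  "nbhd f g L0 Lg \<theta>' z0 lam =
     {(x, y). 0 \<le> y \<and> lam * quad_bound L0 Lg y (sqrt (Psi f g z0 lam (x, y))) \<le> \<theta>'}"

definition rho :: "real \<Rightarrow> real^'m \<Rightarrow> real^'m \<Rightarrow> real \<Rightarrow> real" where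
  "rho L0 Lg y \<alpha> = (GREATEST \<rho>. quad_bound L0 Lg y \<rho> = \<alpha>)"

definition h_root :: "real \<Rightarrow> real \<Rightarrow> real" where
  "h_root \<sigma> \<theta> = (THE h. 0 < h \<and> \<theta> * (1 + h) * (1 + h * (1 + 1 / \<sigma>))\<^sup>2 = 1)"

definition tau :: "real \<Rightarrow> real \<Rightarrow> real" where
  "tau \<sigma> \<theta> = h_root \<sigma> \<theta> / (1 + h_root \<sigma> \<theta>)"

definition minmax_solution :: "('a \<Rightarrow> 'b \<Rightarrow> real) \<Rightarrow> 'b set \<Rightarrow> 'a \<times> 'b \<Rightarrow> bool" where
  "minmax_solution F Y = (\<lambda>(x, y).
     is_arg_min (\<lambda>x'. SUP y'\<in>Y. F x' y') (\<lambda>_. True) x \<and> is_arg_max (F x) (\<lambda>y'. y' \<in> Y) y)"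

definition reg_lagrangian :: "(real^'n \<Rightarrow> real) \<Rightarrow> (real^'n \<Rightarrow> real^'m) \<Rightarrow> real^'n
    \<Rightarrow> (real^'n) \<times> (real^'m) \<Rightarrow> real \<Rightarrow> real^'n \<Rightarrow> real^'m \<Rightarrow> real" where
  "reg_lagrangian f g a z lam x y =
     taylor2 f a x + y \<bullet> taylor2_vec g a x
       + ((norm (x - fst z))\<^sup>2 - (norm (y - snd z))\<^sup>2) / (2 * lam)"

definition large_step :: "real \<Rightarrow> real^'m \<Rightarrow> real \<Rightarrow> real \<Rightarrow> (nat \<Rightarrow> (real^'n) \<times> (real^'m))
    \<Rightarrow> (nat \<Rightarrow> (real^'n) \<times> (real^'m)) \<Rightarrow> (nat \<Rightarrow> real) \<Rightarrow> nat \<Rightarrow> bool" where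
  "large_step L0 Lg \<sigma> \<theta> z zt lam k \<longleftrightarrow>
     rho L0 Lg (snd (zt k)) (\<theta>\<^sup>2 / lam k) \<le> \<sigma> * norm (zt k - z (k - 1))"

text \<open>\<open>z k\<close> is \<open>(x\<^sub>k, y\<^sub>k)\<close> for \<open>k \<ge> 0\<close>; \<open>zt k\<close> is the pair with tildes and, like \<open>lam k\<close>, is
  meaningful for \<open>k \<ge> 1\<close> only.\<close>

definition algorithm1 :: "(real^'n \<Rightarrow> real) \<Rightarrow> (real^'n \<Rightarrow> real^'m) \<Rightarrow> real \<Rightarrow> real^'m
    \<Rightarrow> real \<Rightarrow> real \<Rightarrow> (nat \<Rightarrow> (real^'n) \<times> (real^'m)) \<Rightarrow> (nat \<Rightarrow> (real^'n) \<times> (real^'m))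
    \<Rightarrow> (nat \<Rightarrow> real) \<Rightarrow> bool" where
  "algorithm1 f g L0 Lg \<sigma> \<theta> z zt lam \<longleftrightarrow>
     z 0 = zt 1 \<and> 0 \<le> snd (z 0) \<and> 0 < \<sigma> \<and> \<sigma> < 1 \<and> 0 < \<theta> \<and> \<theta> \<le> 1 / 4 \<and>
     0 < lam 1 \<and> zt 1 \<in> nbhd f g L0 Lg (\<theta>\<^sup>2) (z 0) (lam 1) \<and> zt 1 \<notin> KKT f g \<and>
     (\<forall>k\<ge>1.
        let \<tau> = tau \<sigma> \<theta>;
            x = fst (z (k - 1)); y = snd (z (k - 1)); xt = fst (zt k); yt = snd (zt k)
        in if large_step L0 Lg \<sigma> \<theta> z zt lam k
           then lam (k + 1) = (1 - \<tau>) * lam k \<and> zt (k + 1) = zt k \<and>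
             z k = (x - (\<tau> * lam k) *\<^sub>R (grad f xt + gradmat g xt *v yt),
                    y + \<tau> *\<^sub>R (lam k *\<^sub>R g xt + neg_part (lam k *\<^sub>R g xt + y)))
           else lam (k + 1) = inverse (1 - \<tau>) * lam k \<and> z k = z (k - 1) \<and>
             minmax_solution (reg_lagrangian f g xt (z k) (lam (k + 1))) {0..} (zt (k + 1)))"

definition ext_lagrangian ::
    "(real^'n \<Rightarrow> real) \<Rightarrow> (real^'n \<Rightarrow> real^'m) \<Rightarrow> real^'n \<Rightarrow> real^'m \<Rightarrow> ereal" where
  "ext_lagrangian f g x y = (if 0 \<le> y then ereal (f x + y \<bullet> g x) else - \<infinity>)"

text \<open>In \<^term>\<open>lagrangian_gap f g (x, y)\<close> no difference of equal infinities occurs when \<open>y \<ge> 0\<close>.\<close>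

definition lagrangian_gap :: "(real^'n \<Rightarrow> real) \<Rightarrow> (real^'n \<Rightarrow> real^'m)
    \<Rightarrow> (real^'n) \<times> (real^'m) \<Rightarrow> (real^'n) \<times> (real^'m) \<Rightarrow> ereal" where
  "lagrangian_gap f g = (\<lambda>(x, y) (x', y'). ext_lagrangian f g x' y - ext_lagrangian f g x y')"

definition eps_subdiff :: "real \<Rightarrow> ('a::real_inner \<Rightarrow> ereal) \<Rightarrow> 'a \<Rightarrow> 'a set" where
  "eps_subdiff \<epsilon> \<phi> z = {v. 0 \<le> \<epsilon> \<and> (\<forall>z'. \<phi> z + ereal (v \<bullet> (z' - z) - \<epsilon>) \<le> \<phi> z')}"

end

theory Submission imports Defs begin

text \<open>
  Each large step of the algorithm is an under-relaxed hybrid proximal extragradient (HPE) step for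
  the saddle operator of the Lagrangian. The engine is the invariant
  \<open>zt k \<in> nbhd \<theta>\<^sup>2 (z (k - 1)) (lam k)\<close>: a large step shrinks \<open>lam\<close> and moves \<open>z\<close> so that the proximal
  residual does not grow; in the other case the increase of \<open>lam\<close> by the factor \<open>1 + h\<close> costs at most
  the passage from \<open>\<theta>\<^sup>2\<close> to \<open>\<theta>\<close>, by the choice of \<open>h\<close>, and one Newton step, quadratically convergent,
  returns to \<open>\<theta>\<^sup>2\<close>. The invariant gives the relative error criterion of HPE, and the size of \<open>\<rho>\<^sub>k\<close> gives
  \<open>lam k * \<parallel>zt k - z (k - 1)\<parallel> \<ge> \<eta>\<close>. Fejer monotonicity bounds the sum of the squared step lengths,
  from which the pointwise rates follow for the shortest step. By convexity the sum of the \<open>lam\<close>'s is at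
  least of order \<open>i\<^sup>3\<^sup>/\<^sup>2\<close>, which yields the ergodic rates.
\<close>

section \<open>Taylor models of functions with Lipschitz Hessian\<close>

text \<open>There is an apparent circle: the lower bound \<open>\<eta>\<close> on
  \<open>lam k\<close> times the step length requires control of how far the multipliers drift from
  \<open>snd (z 0)\<close>, that is, distance bounds for the iterates. These bounds follow from the
  relative error criterion alone. Hence the abstract analysis is split: \<open>relaxed_hpe\<close>
  bounds all distances in terms of \<open>d0\<close>, the convex problem turns them into
  \<open>\<eta>\<close>, and only then does \<open>large_step_hpe\<close> apply. The
  \<open>w\<close> in \<open>Psi\<close> explains why one number controls everything: for
  \<open>0 \<le> w\<close>, the vector \<open>- w\<close> is normal to the orthant at
  \<open>y\<close> up to the error \<open>y \<bullet> w\<close>. So \<open>Psi\<close> measures at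
  once the residual of the proximal inclusion and the enlargement that becomes
  \<open>\<epsilon>\<close>.\<close>

lemma has_derivative_along_segment:
  fixes f :: "'a::real_normed_vector \<Rightarrow> 'b::real_normed_vector"
  assumes "(f has_derivative f') (at (x + t *\<^sub>R d))"
  shows "((\<lambda>t. f (x + t *\<^sub>R d)) has_vector_derivative f' d) (at t within S)"
proof -
  have "((\<lambda>t. x + t *\<^sub>R d) has_derivative (\<lambda>s. s *\<^sub>R d)) (at t)"
    by (auto intro!: derivative_eq_intros)
  from diff_chain_at[OF this] assms
  have "((\<lambda>t. f (x + t *\<^sub>R d)) has_derivative (\<lambda>s. f' (s *\<^sub>R d))) (at t)"
    by (simp add: o_def)
  then have "((\<lambda>t. f (x + t *\<^sub>R d)) has_derivative (\<lambda>s. s *\<^sub>R f' d)) (at t)"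
    using linear_scale[OF has_derivative_linear[OF assms]] by simp
  then show ?thesis
    unfolding has_vector_derivative_def by (rule has_derivative_at_withinI)
qed

text \<open>Restriction to the line through \<open>x\<close> and \<open>y\<close> reduces this to
  the tangent inequality in one real variable.\<close>

lemma convex_above_tangent:
  fixes f :: "'a::real_normed_vector \<Rightarrow> real"
  assumes "convex_on UNIV f" and "(f has_derivative f') (at x)"
  shows "f x + f' (y - x) \<le> f y"
proof -
  let ?h = "\<lambda>t::real. f (x + t *\<^sub>R (y - x))"
  have "convex_on UNIV ?h"
  proof (rule convex_onI)
    fix t a b :: real assume "0 < t" "t < 1"
    then have "f ((1 - t) *\<^sub>R (x + a *\<^sub>R (y - x)) + t *\<^sub>R (x + b *\<^sub>R (y - x)))
        \<le> (1 - t) * ?h a + t * ?h b"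
      using convex_onD[OF assms(1), of t] by simp
    moreover have "(1 - t) *\<^sub>R (x + a *\<^sub>R (y - x)) + t *\<^sub>R (x + b *\<^sub>R (y - x))
        = x + ((1 - t) * a + t * b) *\<^sub>R (y - x)"
      by (simp add: algebra_simps)
    ultimately show "?h ((1 - t) *\<^sub>R a + t *\<^sub>R b) \<le> (1 - t) * ?h a + t * ?h b" by simp
  qed simp
  moreover have "(?h has_field_derivative f' (y - x)) (at 0)"
    using has_derivative_along_segment[of f f' x 0 "y - x" UNIV] assms(2)
    by (simp add: has_real_derivative_iff_has_vector_derivative)
  ultimately show ?thesis
    using convex_on_imp_above_tangent[of UNIV ?h 0 1 "f' (y - x)"] by simp
qed

text \<open>\<open>grad\<close> is a definite description, so existence and uniqueness are both due:
  the values of the derivative on the basis are the coordinates of a representing vector, and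
  derivatives are unique.\<close>

lemma has_derivative_grad:
  fixes f :: "real^'n \<Rightarrow> real"
  assumes "f differentiable (at x)"
  shows "(f has_derivative (\<lambda>h. grad f x \<bullet> h)) (at x)"
proof -
  obtain f' where f': "(f has_derivative f') (at x)"
    using assms unfolding differentiable_def by blast
  interpret linear f' using f' by (rule has_derivative_linear)
  have "f' = (\<lambda>h. h \<bullet> (\<Sum>b\<in>Basis. f' b *\<^sub>R b))"
  proof
    fix h
    have "f' h = f' (\<Sum>b\<in>Basis. (h \<bullet> b) *\<^sub>R b)" by (simp add: euclidean_representation)
    then show "f' h = h \<bullet> (\<Sum>b\<in>Basis. f' b *\<^sub>R b)"
      by (simp add: sum scale inner_sum_right mult.commute)
  qed
  with f' have D: "GDERIV f x :> (\<Sum>b\<in>Basis. f' b *\<^sub>R b)" unfolding gderiv_def by simp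
  have "GDERIV f x :> grad f x" unfolding grad_def
  proof (rule theI[of "\<lambda>D. GDERIV f x :> D", OF D])
    fix E assume "GDERIV f x :> E"
    then have "(\<lambda>h. h \<bullet> E) = (\<lambda>h. h \<bullet> (\<Sum>b\<in>Basis. f' b *\<^sub>R b))"
      using D unfolding gderiv_def by (rule has_derivative_unique)
    then show "E = (\<Sum>b\<in>Basis. f' b *\<^sub>R b)"
      by (subst vector_eq_ldot[symmetric]) (simp add: fun_eq_iff)
  qed
  then show ?thesis unfolding gderiv_def by (simp add: inner_commute)
qed

locale lipschitz_hessian =
  fixes f :: "real^'n \<Rightarrow> real" and L :: real
  assumes C2: "C2 f" and lip: "L-lipschitz_on UNIV (hessian f)"
begin

abbreviation H where "H x \<equiv> blinfun_apply (hessian f x)"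

lemma L_nonneg: "0 \<le> L"
  using lip by (rule lipschitz_on_nonneg)

lemma deriv_f: "(f has_derivative (\<lambda>h. grad f x \<bullet> h)) (at x)"
  using C2 by (simp add: C2_def has_derivative_grad)

lemma deriv_grad: "(grad f has_derivative H x) (at x)"
proof -
  have "(grad f has_derivative frechet_derivative (grad f) (at x)) (at x)"
    using C2 by (simp add: C2_def flip: frechet_derivative_works)
  then show ?thesis
    by (simp add: hessian_def bounded_linear_Blinfun_apply has_derivative_bounded_linear)
qed

lemma hessian_lipschitz: "norm (H x d - H y d) \<le> L * norm (x - y) * norm d"
proof -
  have "norm (H x d - H y d) \<le> norm (hessian f x - hessian f y) * norm d"
    by (metis blinfun.diff_left norm_blinfun)
  also have "\<dots> \<le> L * norm (x - y) * norm d"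
    using lipschitz_onD[OF lip, of x y] by (intro mult_right_mono) (auto simp: dist_norm)
  finally show ?thesis .
qed

text \<open>Mean value inequality in comparison form on [0, 1]: along the segment, the derivative of
  the error is dominated by that of the scalar majorant
  \<open>L / 2 * t\<^sup>2 * (norm d)\<^sup>2\<close>.\<close>

lemma grad_taylor: "norm (grad f (x + d) - grad f x - H x d) \<le> L / 2 * (norm d)\<^sup>2"
proof -
  let ?F = "\<lambda>t. grad f (x + t *\<^sub>R d) - t *\<^sub>R H x d"
  have d: "(?F has_vector_derivative H (x + t *\<^sub>R d) d - H x d) (at t within S)" for t S
    using has_derivative_along_segment[OF deriv_grad]
    by (auto intro!: derivative_eq_intros simp: has_vector_derivative_def scaleR_diff_right)
  have p: "((\<lambda>t. L / 2 * t\<^sup>2 * (norm d)\<^sup>2) has_vector_derivative L * t * (norm d)\<^sup>2) (at t within S)"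
    for t S
    unfolding has_real_derivative_iff_has_vector_derivative[symmetric]
    by (auto intro!: derivative_eq_intros)
  have "norm (?F 1 - ?F 0) \<le> L / 2 * 1\<^sup>2 * (norm d)\<^sup>2 - L / 2 * 0\<^sup>2 * (norm d)\<^sup>2"
  proof (rule differentiable_bound_general[OF _ _ _ d p])
    show "continuous_on {0..1} ?F"
      by (rule continuous_on_vector_derivative) (rule d)
    show "norm (H (x + t *\<^sub>R d) d - H x d) \<le> L * t * (norm d)\<^sup>2" if "0 < t" "t < 1" for t
      using hessian_lipschitz[of "x + t *\<^sub>R d" d x] that by (simp add: power2_eq_square mult_ac)
  qed (auto intro!: continuous_intros)
  then show ?thesis by (simp add: algebra_simps)
qed

text \<open>The same comparison one order higher: the remainder along the segment has as derivative
  the error of \<open>grad_taylor\<close> for \<open>t *\<^sub>R d\<close>, paired with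
  \<open>d\<close>.\<close>

lemma taylor2_error: "\<bar>f (x + d) - taylor2 f x (x + d)\<bar> \<le> L / 6 * (norm d)^3"
proof -
  let ?F = "\<lambda>t. f (x + t *\<^sub>R d) - t * (grad f x \<bullet> d) - t\<^sup>2 / 2 * (d \<bullet> H x d)"
  have "((\<lambda>t. f (x + t *\<^sub>R d)) has_real_derivative grad f (x + t *\<^sub>R d) \<bullet> d) (at t within S)" for t S
    unfolding has_real_derivative_iff_has_vector_derivative
    using has_derivative_along_segment[OF deriv_f] by blast
  then have d: "(?F has_vector_derivative (grad f (x + t *\<^sub>R d) - grad f x - H x (t *\<^sub>R d)) \<bullet> d)
      (at t within S)" for t S
    unfolding has_real_derivative_iff_has_vector_derivative[symmetric]
    by (auto intro!: derivative_eq_intros simp: inner_diff blinfun.scaleR_right inner_commute[of _ d])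
  have p: "((\<lambda>t. L / 6 * t^3 * (norm d)^3) has_vector_derivative L / 2 * t\<^sup>2 * (norm d)^3) (at t within S)"
    for t S
    unfolding has_real_derivative_iff_has_vector_derivative[symmetric]
    by (auto intro!: derivative_eq_intros)
  have "norm (?F 1 - ?F 0) \<le> L / 6 * 1^3 * (norm d)^3 - L / 6 * 0^3 * (norm d)^3"
  proof (rule differentiable_bound_general[OF _ _ _ d p])
    show "continuous_on {0..1} ?F"
      by (rule continuous_on_vector_derivative) (rule d)
    fix t :: real assume t: "0 < t" "t < 1"
    have "norm ((grad f (x + t *\<^sub>R d) - grad f x - H x (t *\<^sub>R d)) \<bullet> d)
        \<le> norm (grad f (x + t *\<^sub>R d) - grad f x - H x (t *\<^sub>R d)) * norm d"
      by (simp add: Cauchy_Schwarz_ineq2)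
    also have "\<dots> \<le> L / 2 * (norm (t *\<^sub>R d))\<^sup>2 * norm d"
      by (intro mult_right_mono grad_taylor) auto
    finally show "norm ((grad f (x + t *\<^sub>R d) - grad f x - H x (t *\<^sub>R d)) \<bullet> d)
        \<le> L / 2 * t\<^sup>2 * (norm d)^3"
      by (simp add: power2_eq_square power3_eq_cube mult_ac)
  qed (auto intro!: continuous_intros)
  then show ?thesis by (simp add: taylor2_def algebra_simps)
qed

text \<open>Both sides arise by expanding \<open>f (x + u + v)\<close> once through \<open>x + u\<close> and once through
  \<open>x + v\<close>; the errors are of third order, so scaling \<open>u\<close> and \<open>v\<close> to zero removes them.\<close>

lemma hessian_symmetric: "u \<bullet> H x v = v \<bullet> H x u"
proof -
  define M where "M = norm u + norm v"
  \<comment> \<open>The four remainders below contribute 1/6, 1/6, 1/2 and, after halving, 1/2 times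
    \<open>L * (norm u + norm v)^3\<close>; the factor 2 rounds up their total 4/3.\<close>
  have expand: "\<bar>f (x + u + v) - (f x + grad f x \<bullet> (u + v) + (u \<bullet> H x u) / 2 + v \<bullet> H x u + (v \<bullet> H x v) / 2)\<bar>
      \<le> 2 * L * (norm u + norm v)^3" for u v
  proof -
    let ?S = "norm u + norm v"
    have S: "norm u \<le> ?S" "norm v \<le> ?S" "0 \<le> ?S" by auto
    have b: "L * (norm a * norm b * norm c) \<le> L * ?S^3"
      if "norm a \<le> ?S" "norm b \<le> ?S" "norm c \<le> ?S" for a b c :: "real^'n"
      using that by (auto intro!: mult_left_mono mult_mono L_nonneg simp: power3_eq_cube)
    have 1: "\<bar>f (x + u + v) - taylor2 f (x + u) (x + u + v)\<bar> \<le> L * ?S^3 / 6"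
      using taylor2_error[of "x + u" v] b[of v v v] S by (simp add: power3_eq_cube)
    have 2: "\<bar>f (x + u) - taylor2 f x (x + u)\<bar> \<le> L * ?S^3 / 6"
      using taylor2_error[of x u] b[of u u u] S by (simp add: power3_eq_cube)
    have "\<bar>(grad f (x + u) - grad f x - H x u) \<bullet> v\<bar> \<le> L / 2 * (norm u)\<^sup>2 * norm v"
      by (rule order_trans[OF Cauchy_Schwarz_ineq2])
        (intro mult_right_mono grad_taylor norm_ge_zero)
    then have 3: "\<bar>(grad f (x + u) - grad f x - H x u) \<bullet> v\<bar> \<le> L * ?S^3 / 2"
      using b[of u u v] S by (simp add: power2_eq_square)
    have "\<bar>v \<bullet> (H (x + u) v - H x v)\<bar> \<le> norm v * (L * norm u * norm v)"
      using hessian_lipschitz[of "x + u" v x]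
      by (intro order_trans[OF Cauchy_Schwarz_ineq2] mult_left_mono) auto
    then have 4: "\<bar>v \<bullet> (H (x + u) v - H x v)\<bar> \<le> L * ?S^3"
      using b[of v u v] S by (simp add: mult_ac)
    have "f (x + u + v) - (f x + grad f x \<bullet> (u + v) + (u \<bullet> H x u) / 2 + v \<bullet> H x u + (v \<bullet> H x v) / 2)
        = (f (x + u + v) - taylor2 f (x + u) (x + u + v)) + (f (x + u) - taylor2 f x (x + u))
        + (grad f (x + u) - grad f x - H x u) \<bullet> v + (v \<bullet> (H (x + u) v - H x v)) / 2"
      by (simp add: taylor2_def inner_add inner_diff inner_commute[of v] field_simps)
    with 1 2 3 4 show ?thesis by linarith
  qed
  have small: "\<bar>v \<bullet> H x u - u \<bullet> H x v\<bar> \<le> 4 * L * t * M^3" if "0 < t" for t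
  proof -
    have A: "\<bar>f (x + t *\<^sub>R u + t *\<^sub>R v) - (f x + grad f x \<bullet> (t *\<^sub>R u + t *\<^sub>R v)
       + (t *\<^sub>R u \<bullet> H x (t *\<^sub>R u)) / 2 + t *\<^sub>R v \<bullet> H x (t *\<^sub>R u) + (t *\<^sub>R v \<bullet> H x (t *\<^sub>R v)) / 2)\<bar>
      \<le> 2 * L * (t * M)^3"
      using expand[of "t *\<^sub>R u" "t *\<^sub>R v"] that by (simp add: M_def algebra_simps)
    have B: "\<bar>f (x + t *\<^sub>R u + t *\<^sub>R v) - (f x + grad f x \<bullet> (t *\<^sub>R u + t *\<^sub>R v)
       + (t *\<^sub>R v \<bullet> H x (t *\<^sub>R v)) / 2 + t *\<^sub>R u \<bullet> H x (t *\<^sub>R v) + (t *\<^sub>R u \<bullet> H x (t *\<^sub>R u)) / 2)\<bar>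
      \<le> 2 * L * (t * M)^3"
      using expand[of "t *\<^sub>R v" "t *\<^sub>R u"] that by (simp add: M_def algebra_simps)
    have "\<bar>t *\<^sub>R v \<bullet> H x (t *\<^sub>R u) - t *\<^sub>R u \<bullet> H x (t *\<^sub>R v)\<bar> \<le> 4 * L * (t * M)^3"
      using A B by linarith
    moreover have "t *\<^sub>R v \<bullet> H x (t *\<^sub>R u) - t *\<^sub>R u \<bullet> H x (t *\<^sub>R v) = t\<^sup>2 * (v \<bullet> H x u - u \<bullet> H x v)"
      by (simp add: blinfun.scaleR_right power2_eq_square algebra_simps)
    ultimately have "t\<^sup>2 * \<bar>v \<bullet> H x u - u \<bullet> H x v\<bar> \<le> t\<^sup>2 * (4 * L * t * M^3)"
      by (simp add: abs_mult power2_eq_square power3_eq_cube mult_ac)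
    then show ?thesis using that by simp
  qed
  have "((\<lambda>t. 4 * L * t * M^3) \<longlongrightarrow> 4 * L * 0 * M^3) (at_right 0)"
    by (intro tendsto_intros)
  then have "\<bar>v \<bullet> H x u - u \<bullet> H x v\<bar> \<le> 4 * L * 0 * M^3"
    using small by (intro tendsto_lowerbound[of _ _ "at_right 0"]) (auto simp: eventually_at_right_less eventually_at_filter)
  then show ?thesis by simp
qed

text \<open>Differentiating the quadratic term yields the mean of \<open>H a\<close> and its
  transpose; symmetry of the Hessian turns this into the linearised gradient of a Newton
  model.\<close>

lemma taylor2_has_derivative:
  "(taylor2 f a has_derivative (\<lambda>h. (grad f a + H a (x - a)) \<bullet> h)) (at x)"
proof -
  have "(taylor2 f a has_derivative (\<lambda>h. grad f a \<bullet> h + ((x - a) \<bullet> H a h + h \<bullet> H a (x - a)) / 2)) (at x)"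
    unfolding taylor2_def [abs_def]
    by (auto intro!: derivative_eq_intros bounded_linear.has_derivative[OF blinfun.bounded_linear_right] simp: field_simps)
  moreover have "(x - a) \<bullet> H a h = h \<bullet> H a (x - a)" for h by (rule hessian_symmetric)
  ultimately show ?thesis by (simp add: inner_add_left inner_add_right inner_commute)
qed

lemma taylor2_second_order:
  "taylor2 f a y = taylor2 f a x + (grad f a + H a (x - a)) \<bullet> (y - x) + ((y - x) \<bullet> H a (y - x)) / 2"
proof -
  define u where "u = x - a"
  define d where "d = y - x"
  have e: "y - a = u + d" "x - a = u" "y - x = d" by (auto simp: u_def d_def)
  show ?thesis
    using hessian_symmetric[of u a d]
    by (simp add: taylor2_def e blinfun.add_right inner_add inner_commute[of d] field_simps)
qed

text \<open>The tangent inequality at \<open>x + t *\<^sub>R d\<close> and the cubic remainder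
  leave, after division by \<open>t\<^sup>2 / 2\<close>, a lower bound that vanishes with
  \<open>t\<close>. Thus Taylor models of convex functions are convex, which makes the Newton
  subproblem monotone.\<close>

lemma hessian_psd:
  assumes "convex_on UNIV f"
  shows "0 \<le> d \<bullet> H x d"
proof -
  have "- (L / 3 * t * (norm d)^3) \<le> d \<bullet> H x d" if "0 < t" for t
  proof -
    have "f (x + t *\<^sub>R d) - taylor2 f x (x + t *\<^sub>R d) \<le> L / 6 * (norm (t *\<^sub>R d))^3"
      using taylor2_error[of x "t *\<^sub>R d"] by linarith
    with convex_above_tangent[OF assms deriv_f, of x "x + t *\<^sub>R d"]
    have "0 \<le> (d \<bullet> H x d) * t\<^sup>2 / 2 + L / 6 * t^3 * (norm d)^3"
      using that
      by (simp add: taylor2_def blinfun.scaleR_right power_mult_distrib power2_eq_square mult_ac)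
    then have "0 \<le> t\<^sup>2 / 2 * (d \<bullet> H x d + L / 3 * t * (norm d)^3)"
      by (simp add: algebra_simps power2_eq_square power3_eq_cube)
    then show ?thesis using that by (simp add: zero_le_mult_iff)
  qed
  moreover have "((\<lambda>t. - (L / 3 * t * (norm d)^3)) \<longlongrightarrow> - (L / 3 * 0 * (norm d)^3)) (at_right 0)"
    by (intro tendsto_intros)
  ultimately have "- (L / 3 * 0 * (norm d)^3) \<le> d \<bullet> H x d"
    by (intro tendsto_upperbound[of _ _ "at_right 0"]) (auto simp: eventually_at_filter)
  then show ?thesis by simp
qed

lemma taylor2_above_tangent:
  assumes "convex_on UNIV f"
  shows "taylor2 f a x + (grad f a + H a (x - a)) \<bullet> (y - x) \<le> taylor2 f a y"
  using taylor2_second_order[of a y x] hessian_psd[OF assms, of "y - x" a] by simp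

end

section \<open>Under-relaxed large-step HPE sequences\<close>

text \<open>Expanding the square in the criterion bounds
  \<open>lam\<^sup>2 * (v \<bullet> v)\<close>. The relaxed step produces this term with
  \<open>\<tau>\<^sup>2\<close>, the criterion multiplied by \<open>\<tau>\<close> offers it with
  \<open>\<tau>\<close>, and \<open>\<tau> \<le> 1\<close> closes the gap. The point
  \<open>x\<close> is left free: a solution gives Fejer monotonicity, the ergodic mean gives the
  ergodic error.\<close>

lemma hpe_step:
  fixes z zt v x :: "'a::real_inner"
  assumes "(norm (lam *\<^sub>R v + zt - z))\<^sup>2 + 2 * lam * \<epsilon> \<le> \<sigma>\<^sup>2 * (norm (zt - z))\<^sup>2"
    and "0 \<le> \<tau>" "\<tau> \<le> 1"
  shows "(norm (x - (z - (\<tau> * lam) *\<^sub>R v)))\<^sup>2 + 2 * (\<tau> * lam * (\<epsilon> + v \<bullet> (zt - x)))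
    + \<tau> * (1 - \<sigma>\<^sup>2) * (norm (zt - z))\<^sup>2 \<le> (norm (x - z))\<^sup>2"
proof -
  define y d where "y = x - z" and "d = zt - z"
  have e: "lam *\<^sub>R v + zt - z = lam *\<^sub>R v + d" "x - (z - (\<tau> * lam) *\<^sub>R v) = y + (\<tau> * lam) *\<^sub>R v"
    "zt - x = d - y" "zt - z = d" "x - z = y"
    by (auto simp: y_def d_def)
  have n: "(norm (a + b))\<^sup>2 = a \<bullet> a + 2 * (a \<bullet> b) + b \<bullet> b" for a b :: 'a
    unfolding power2_norm_eq_inner by (simp add: inner_add inner_commute)
  have "lam\<^sup>2 * (v \<bullet> v) + 2 * lam * (v \<bullet> d) + (1 - \<sigma>\<^sup>2) * (d \<bullet> d) + 2 * lam * \<epsilon> \<le> 0"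
    using assms(1) unfolding e n power2_norm_eq_inner[of d] by (simp add: algebra_simps power2_eq_square)
  then have "\<tau> * (lam\<^sup>2 * (v \<bullet> v) + 2 * lam * (v \<bullet> d) + (1 - \<sigma>\<^sup>2) * (d \<bullet> d) + 2 * lam * \<epsilon>) \<le> 0"
    using assms(2) by (simp add: mult_nonneg_nonpos)
  moreover have "\<tau>\<^sup>2 * (lam\<^sup>2 * (v \<bullet> v)) \<le> \<tau> * (lam\<^sup>2 * (v \<bullet> v))"
    using assms(2,3) by (intro mult_right_mono) (auto simp: power2_eq_square mult_left_le)
  ultimately show ?thesis
    unfolding e n power2_norm_eq_inner[of d] power2_norm_eq_inner[of y]
    by (simp add: algebra_simps power2_eq_square inner_commute)
qed

lemma powr_three_halves: "0 \<le> x \<Longrightarrow> x powr (3/2) = x * sqrt x" for x :: real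
  using powr_add[of x 1 "1/2"] by (cases "x = 0") (auto simp: powr_half_sqrt)

text \<open>Indices are confined to \<open>{1..N}\<close> because there may be only finitely many
  large steps. What is retained of the problem is \<open>monotone_zs\<close>, the inequality of the
  enlarged operator against one solution \<open>zs\<close>.\<close>

locale relaxed_hpe =
  fixes Z zt v :: "nat \<Rightarrow> 'a::real_inner" and \<epsilon> lam :: "nat \<Rightarrow> real"
    and \<sigma> \<tau> d0 :: real and zs :: 'a and N :: nat
  assumes \<sigma>: "0 < \<sigma>" "\<sigma> < 1" and \<tau>: "0 < \<tau>" "\<tau> \<le> 1"
    and lam_pos: "\<And>j. j \<in> {1..N} \<Longrightarrow> 0 < lam j"
    and Z_step: "\<And>j. j \<in> {1..N} \<Longrightarrow> Z j = Z (j - 1) - (\<tau> * lam j) *\<^sub>R v j"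
    and error: "\<And>j. j \<in> {1..N} \<Longrightarrow>
      (norm (lam j *\<^sub>R v j + zt j - Z (j - 1)))\<^sup>2 + 2 * lam j * \<epsilon> j \<le> \<sigma>\<^sup>2 * (norm (zt j - Z (j - 1)))\<^sup>2"
    and \<epsilon>_nonneg: "\<And>j. j \<in> {1..N} \<Longrightarrow> 0 \<le> \<epsilon> j"
    and monotone_zs: "\<And>j. j \<in> {1..N} \<Longrightarrow> 0 \<le> \<epsilon> j + v j \<bullet> (zt j - zs)"
    and d0: "d0 = norm (Z 0 - zs)"
begin

abbreviation D where "D j \<equiv> norm (zt j - Z (j - 1))"

lemma \<sigma>_sq: "0 < 1 - \<sigma>\<^sup>2" "0 < sqrt (1 - \<sigma>\<^sup>2)"
  using \<sigma> by (auto simp: power_less_one_iff)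

lemma d0_nonneg: "0 \<le> d0"
  by (simp add: d0)

lemma telescoped:
  "n \<le> N \<Longrightarrow> (norm (x - Z n))\<^sup>2 + 2 * (\<Sum>j=1..n. \<tau> * lam j * (\<epsilon> j + v j \<bullet> (zt j - x)))
    + \<tau> * (1 - \<sigma>\<^sup>2) * (\<Sum>j=1..n. (D j)\<^sup>2) \<le> (norm (x - Z 0))\<^sup>2"
proof (induction n)
  case (Suc n)
  have "Suc n \<in> {1..N}" using Suc.prems by auto
  then have "(norm (x - Z (Suc n)))\<^sup>2
      + 2 * (\<tau> * lam (Suc n) * (\<epsilon> (Suc n) + v (Suc n) \<bullet> (zt (Suc n) - x)))
      + \<tau> * (1 - \<sigma>\<^sup>2) * (D (Suc n))\<^sup>2 \<le> (norm (x - Z n))\<^sup>2"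
    using hpe_step[OF error, of "Suc n" \<tau> x] \<tau> Z_step[of "Suc n"] by simp
  with Suc show ?case
    by (simp add: distrib_left)
qed simp

lemma sum_D: "\<tau> * (1 - \<sigma>\<^sup>2) * (\<Sum>j=1..N. (D j)\<^sup>2) \<le> d0\<^sup>2"
  and Z_dist: "n \<le> N \<Longrightarrow> norm (zs - Z n) \<le> d0"
proof -
  have *: "(norm (zs - Z n))\<^sup>2 + \<tau> * (1 - \<sigma>\<^sup>2) * (\<Sum>j=1..n. (D j)\<^sup>2) \<le> d0\<^sup>2" if "n \<le> N" for n
  proof -
    have "0 \<le> (\<Sum>j=1..n. \<tau> * lam j * (\<epsilon> j + v j \<bullet> (zt j - zs)))"
      using that lam_pos monotone_zs \<tau> by (intro sum_nonneg mult_nonneg_nonneg) (auto intro: less_imp_le)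
    then show ?thesis using telescoped[OF that, of zs] by (simp add: d0 norm_minus_commute)
  qed
  show "\<tau> * (1 - \<sigma>\<^sup>2) * (\<Sum>j=1..N. (D j)\<^sup>2) \<le> d0\<^sup>2"
    using *[of N] zero_le_power2[of "norm (zs - Z N)"] by linarith
  show "norm (zs - Z n) \<le> d0" if "n \<le> N"
  proof (rule power2_le_imp_le[OF _ d0_nonneg])
    have "0 \<le> \<tau> * (1 - \<sigma>\<^sup>2) * (\<Sum>j=1..n. (D j)\<^sup>2)"
      using \<tau> \<sigma>_sq by (intro mult_nonneg_nonneg sum_nonneg) auto
    then show "(norm (zs - Z n))\<^sup>2 \<le> d0\<^sup>2" using *[OF that] by linarith
  qed
qed

text \<open>The full step \<open>u = Z (j - 1) - lam j *\<^sub>R v j\<close> gives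
  \<open>\<parallel>zs - u\<parallel>\<^sup>2 + (1 - \<sigma>\<^sup>2) D\<^sup>2 \<le> d0\<^sup>2\<close> and \<open>\<parallel>zt j - u\<parallel> \<le> \<sigma> D\<close>; combine by Cauchy--Schwarz.\<close>

lemma D_bound: "j \<in> {1..N} \<Longrightarrow> D j \<le> d0 / sqrt (1 - \<sigma>\<^sup>2)"
  and zt_dist: "j \<in> {1..N} \<Longrightarrow> norm (zt j - zs) \<le> d0 / sqrt (1 - \<sigma>\<^sup>2)"
proof -
  assume j: "j \<in> {1..N}"
  define a where "a = norm (zs - (Z (j - 1) - lam j *\<^sub>R v j))"
  define s where "s = sqrt (1 - \<sigma>\<^sup>2)"
  have s: "0 < s" "s\<^sup>2 = 1 - \<sigma>\<^sup>2" using \<sigma>_sq by (auto simp: s_def)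
  have "(norm (zs - Z (j - 1)))\<^sup>2 \<le> d0\<^sup>2"
    using Z_dist[of "j - 1"] j by (intro power_mono) auto
  moreover have "0 \<le> lam j * (\<epsilon> j + v j \<bullet> (zt j - zs))"
    using lam_pos[OF j] monotone_zs[OF j] by simp
  ultimately have *: "a\<^sup>2 + s\<^sup>2 * (D j)\<^sup>2 \<le> d0\<^sup>2"
    using hpe_step[OF error[OF j], of 1 zs] by (simp add: a_def s(2))
  then have "(s * D j)\<^sup>2 \<le> d0\<^sup>2"
    using zero_le_power2[of a] unfolding power_mult_distrib by linarith
  then have "s * D j \<le> d0" using d0_nonneg by (rule power2_le_imp_le)
  then show "D j \<le> d0 / sqrt (1 - \<sigma>\<^sup>2)"
    using s by (simp add: s_def[symmetric] field_simps)
  have "(norm (lam j *\<^sub>R v j + zt j - Z (j - 1)))\<^sup>2 \<le> (\<sigma> * D j)\<^sup>2"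
    using error[OF j] mult_nonneg_nonneg[of "lam j" "\<epsilon> j"] lam_pos[OF j] \<epsilon>_nonneg[OF j]
    unfolding power_mult_distrib by linarith
  then have "norm (lam j *\<^sub>R v j + zt j - Z (j - 1)) \<le> \<sigma> * D j"
    by (rule power2_le_imp_le) (use \<sigma> in simp)
  then have 1: "norm (zt j - zs) \<le> a + \<sigma> * D j"
    using norm_triangle_ineq4[of "lam j *\<^sub>R v j + zt j - Z (j - 1)" "zs - (Z (j - 1) - lam j *\<^sub>R v j)"]
    by (simp add: a_def)
  \<comment> \<open>Lagrange's identity for the vectors \<open>(s, \<sigma>)\<close>, of norm 1, and
    \<open>(a, s * D j)\<close>; the subtracted square is the defect in Cauchy-Schwarz.\<close>
  have "(s * (a + \<sigma> * D j))\<^sup>2 = a\<^sup>2 + s\<^sup>2 * (D j)\<^sup>2 - (\<sigma> * a - s\<^sup>2 * D j)\<^sup>2"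
  proof -
    have q: "\<sigma>\<^sup>2 = 1 - s\<^sup>2" using s by simp
    have "(s * (a + \<sigma> * D j))\<^sup>2 = s\<^sup>2 * a\<^sup>2 + 2 * s\<^sup>2 * \<sigma> * a * D j + s\<^sup>2 * \<sigma>\<^sup>2 * (D j)\<^sup>2"
      by (simp add: algebra_simps power2_eq_square)
    moreover have "(\<sigma> * a - s\<^sup>2 * D j)\<^sup>2 = \<sigma>\<^sup>2 * a\<^sup>2 - 2 * s\<^sup>2 * \<sigma> * a * D j + s\<^sup>2 * s\<^sup>2 * (D j)\<^sup>2"
      by (simp add: algebra_simps power2_eq_square)
    ultimately show ?thesis unfolding q by (simp add: algebra_simps)
  qed
  then have "(s * (a + \<sigma> * D j))\<^sup>2 \<le> d0\<^sup>2" using * zero_le_power2[of "\<sigma> * a - s\<^sup>2 * D j"] by linarith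
  then have "s * (a + \<sigma> * D j) \<le> d0" using d0_nonneg by (rule power2_le_imp_le)
  then have "a + \<sigma> * D j \<le> d0 / sqrt (1 - \<sigma>\<^sup>2)"
    using s by (simp add: s_def[symmetric] field_simps)
  with 1 show "norm (zt j - zs) \<le> d0 / sqrt (1 - \<sigma>\<^sup>2)" by linarith
qed

end

section \<open>Pointwise and ergodic rates under the large-step condition\<close>

locale large_step_hpe = relaxed_hpe +
  fixes \<eta> :: real
  assumes \<eta>: "0 < \<eta>" and N: "1 \<le> N"
    and large: "\<And>j. j \<in> {1..N} \<Longrightarrow> \<eta> \<le> lam j * D j"
begin

lemma D_pos: "j \<in> {1..N} \<Longrightarrow> 0 < D j"
  using large[of j] \<eta> by (cases "D j = 0") auto

lemma d0_pos: "0 < d0"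
proof -
  have "0 < d0 / sqrt (1 - \<sigma>\<^sup>2)"
    using less_le_trans[OF D_pos D_bound, of 1] N by simp
  then show ?thesis using \<sigma>_sq by (simp add: zero_less_divide_iff)
qed

text \<open>The criterion controls \<open>lam j * norm (v j)\<close> by \<open>D j\<close> and
  \<open>lam j * \<epsilon> j\<close> by its square. Since \<open>lam j * D j \<ge> \<eta>\<close>,
  each division by \<open>lam j\<close> costs a factor \<open>D j / \<eta>\<close>, so the orders
  are the second and the third power of \<open>D j\<close>. For the shortest step,
  \<open>D j\<close> is of order \<open>1 / sqrt N\<close>. The factor \<open>1 + \<sigma>\<close>
  in the bound on \<open>v j\<close> combines with \<open>1 - \<sigma>\<close> to
  \<open>1 - \<sigma>\<^sup>2\<close>.\<close>

lemma pointwise: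
  "\<exists>j\<in>{1..N}. norm (v j) \<le> d0\<^sup>2 / (real N * \<tau> * (1 - \<sigma>) * \<eta>) \<and>
     \<epsilon> j \<le> \<sigma>\<^sup>2 * d0 ^ 3 / ((real N * \<tau>) powr (3/2) * (1 - \<sigma>\<^sup>2) powr (3/2) * (2 * \<eta>))"
proof -
  define M where "M = Min (D ` {1..N})"
  have "M \<in> D ` {1..N}" unfolding M_def using N by (intro Min_in) auto
  then obtain j where j: "j \<in> {1..N}" "M = D j" by auto
  have le: "D j \<le> D l" if "l \<in> {1..N}" for l using that unfolding j(2)[symmetric] M_def by simp
  have Dj: "0 < D j" using D_pos j by simp
  have "real N * (D j)\<^sup>2 \<le> (\<Sum>l=1..N. (D l)\<^sup>2)"
    using sum_bounded_below[of "{1..N}" "(D j)\<^sup>2" "\<lambda>l. (D l)\<^sup>2"] le by (simp add: power_mono)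
  then have "\<tau> * (1 - \<sigma>\<^sup>2) * (real N * (D j)\<^sup>2) \<le> \<tau> * (1 - \<sigma>\<^sup>2) * (\<Sum>l=1..N. (D l)\<^sup>2)"
    using \<tau> \<sigma>_sq by (intro mult_left_mono) auto
  with sum_D have D2: "(real N * \<tau>) * (1 - \<sigma>\<^sup>2) * (D j)\<^sup>2 \<le> d0\<^sup>2" by (simp add: mult_ac)
  have lam: "0 < lam j" using lam_pos j by simp
  have err: "(norm (lam j *\<^sub>R v j + zt j - Z (j - 1)))\<^sup>2 + 2 * lam j * \<epsilon> j \<le> (\<sigma> * D j)\<^sup>2"
    using error[OF j(1)] by (simp add: power_mult_distrib)
  then have "(norm (lam j *\<^sub>R v j + zt j - Z (j - 1)))\<^sup>2 \<le> (\<sigma> * D j)\<^sup>2"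
    using mult_nonneg_nonneg[of "lam j" "\<epsilon> j"] lam \<epsilon>_nonneg[OF j(1)] by linarith
  then have "norm (lam j *\<^sub>R v j + zt j - Z (j - 1)) \<le> \<sigma> * D j"
    by (rule power2_le_imp_le) (use \<sigma> in simp)
  moreover have "norm (lam j *\<^sub>R v j) \<le> norm (lam j *\<^sub>R v j + zt j - Z (j - 1)) + D j"
    using norm_triangle_ineq4[of "lam j *\<^sub>R v j + zt j - Z (j - 1)" "zt j - Z (j - 1)"]
    by (simp add: algebra_simps)
  moreover have "norm (lam j *\<^sub>R v j) = lam j * norm (v j)" using lam by simp
  ultimately have "lam j * norm (v j) \<le> \<sigma> * D j + D j" by linarith
  then have "lam j * norm (v j) \<le> (1 + \<sigma>) * D j" by (simp add: distrib_right)
  then have "(lam j * norm (v j)) * D j \<le> (1 + \<sigma>) * D j * D j"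
    using Dj by (intro mult_right_mono) auto
  moreover have "\<eta> * norm (v j) \<le> (lam j * D j) * norm (v j)"
    using large[OF j(1)] by (intro mult_right_mono) auto
  ultimately have v: "\<eta> * norm (v j) \<le> (1 + \<sigma>) * (D j)\<^sup>2"
    by (simp add: power2_eq_square mult_ac)
  have "norm (v j) \<le> d0\<^sup>2 / (real N * \<tau> * (1 - \<sigma>) * \<eta>)"
  proof -
    have pos: "0 < real N * \<tau> * (1 - \<sigma>)" using N \<tau> \<sigma> by simp
    have "(real N * \<tau> * (1 - \<sigma>)) * (\<eta> * norm (v j)) \<le> (real N * \<tau> * (1 - \<sigma>)) * ((1 + \<sigma>) * (D j)\<^sup>2)"
      using v pos by (intro mult_left_mono) auto
    also have "\<dots> = (real N * \<tau>) * (1 - \<sigma>\<^sup>2) * (D j)\<^sup>2" by (simp add: algebra_simps power2_eq_square)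
    finally have "(real N * \<tau> * (1 - \<sigma>)) * (\<eta> * norm (v j)) \<le> d0\<^sup>2" using D2 by linarith
    then show ?thesis using pos \<eta> by (subst pos_le_divide_eq) (auto simp: mult_ac)
  qed
  moreover have "\<epsilon> j \<le> \<sigma>\<^sup>2 * d0 ^ 3 / ((real N * \<tau>) powr (3/2) * (1 - \<sigma>\<^sup>2) powr (3/2) * (2 * \<eta>))"
  proof -
    define q where "q = real N * \<tau> * (1 - \<sigma>\<^sup>2)"
    have q: "0 < q" using N \<tau> \<sigma>_sq by (simp add: q_def)
    have q32: "(real N * \<tau>) powr (3/2) * (1 - \<sigma>\<^sup>2) powr (3/2) = q * sqrt q"
      using \<tau> \<sigma>_sq q by (simp add: q_def powr_mult powr_three_halves real_sqrt_mult)
    have "(sqrt q * D j)\<^sup>2 \<le> d0\<^sup>2" using D2 q by (simp add: power_mult_distrib q_def)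
    then have qD: "sqrt q * D j \<le> d0" using d0_nonneg by (rule power2_le_imp_le)
    have "2 * \<epsilon> j * \<eta> \<le> 2 * \<epsilon> j * (lam j * D j)"
      using large[OF j(1)] \<epsilon>_nonneg[OF j(1)] by (intro mult_left_mono) auto
    also have "\<dots> = (2 * lam j * \<epsilon> j) * D j" by simp
    also have "\<dots> \<le> (\<sigma> * D j)\<^sup>2 * D j"
      using err by (intro mult_right_mono) (auto intro: order_trans[rotated])
    finally have "2 * \<epsilon> j * \<eta> \<le> \<sigma>\<^sup>2 * (D j)^3"
      by (simp add: power2_eq_square power3_eq_cube mult_ac)
    then have "(q * sqrt q) * (2 * \<epsilon> j * \<eta>) \<le> (q * sqrt q) * (\<sigma>\<^sup>2 * (D j)^3)"
      using q by (intro mult_left_mono) auto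
    also have "\<dots> = \<sigma>\<^sup>2 * (sqrt q * D j)^3"
      using q by (simp add: power_mult_distrib power3_eq_cube mult_ac)
    also have "\<dots> \<le> \<sigma>\<^sup>2 * d0^3"
      using qD q by (intro mult_left_mono power_mono) auto
    finally show ?thesis
      unfolding q32 using q \<eta> by (subst pos_le_divide_eq) (auto simp: mult_ac)
  qed
  ultimately show ?thesis using j by blast
qed

text \<open>The factor \<open>1 / Lam * \<tau>\<close> in the next definitions stays unsimplified so
  that they match the ergodic quantities of the final theorem literally.\<close>

definition Lam where "Lam = \<tau> * (\<Sum>j=1..N. lam j)"
definition zta where "zta = (1 / Lam * \<tau>) *\<^sub>R (\<Sum>j=1..N. lam j *\<^sub>R zt j)"
definition va where "va = (1 / Lam * \<tau>) *\<^sub>R (\<Sum>j=1..N. lam j *\<^sub>R v j)"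
definition \<epsilon>a where "\<epsilon>a = 1 / Lam * \<tau> * (\<Sum>j=1..N. lam j * (\<epsilon> j + (zt j - zta) \<bullet> (v j - va)))"

text \<open>The step \<open>1 / D \<ge> 3 / (2m) - D\<^sup>2 / (2m\<^sup>3)\<close> is the tangent of \<open>s \<mapsto> s\<^sup>-\<^sup>1\<^sup>/\<^sup>2\<close> at \<open>m\<^sup>2\<close>.\<close>

lemma Lam_lower: "(real N * \<tau>) powr (3/2) * sqrt (1 - \<sigma>\<^sup>2) * \<eta> / d0 \<le> Lam"
proof -
  define q where "q = real N * \<tau> * (1 - \<sigma>\<^sup>2)"
  have q: "0 < q" using N \<tau> \<sigma>_sq by (simp add: q_def)
  \<comment> \<open>By \<open>sum_D\<close>, the mean of the squares of the \<open>D j\<close> is at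
    most \<open>m\<^sup>2\<close>; a tangent taken there loses nothing when all \<open>D j\<close>
    equal \<open>m\<close>.\<close>
  define m where "m = d0 / sqrt q"
  have m: "0 < m" using d0_pos q by (simp add: m_def)
  have "(\<Sum>j=1..N. (D j)\<^sup>2) \<le> d0\<^sup>2 / (\<tau> * (1 - \<sigma>\<^sup>2))"
    using sum_D \<tau> \<sigma>_sq by (subst pos_le_divide_eq) (auto simp: mult_ac)
  also have "\<dots> = real N * m\<^sup>2"
    using N q by (simp add: m_def power_divide) (simp add: q_def)
  finally have S: "(\<Sum>j=1..N. (D j)\<^sup>2) \<le> real N * m\<^sup>2" .
  have tangent: "3 / (2 * m) - (D j)\<^sup>2 / (2 * m^3) \<le> 1 / D j" if "j \<in> {1..N}" for j
  proof -
    have "0 \<le> (D j - m)\<^sup>2 * (D j + 2 * m)" using m by simp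
    then have "3 * m\<^sup>2 * D j - (D j)^3 \<le> 2 * m^3"
      by (simp add: algebra_simps power2_eq_square power3_eq_cube)
    then have "(3 * m\<^sup>2 * D j - (D j)^3) / (2 * m^3 * D j) \<le> 2 * m^3 / (2 * m^3 * D j)"
      using m D_pos[OF that] by (intro divide_right_mono) auto
    moreover have "(3 * m\<^sup>2 * D j - (D j)^3) / (2 * m^3 * D j) = 3 / (2 * m) - (D j)\<^sup>2 / (2 * m^3)"
      using m D_pos[OF that] by (simp add: field_simps power2_eq_square power3_eq_cube)
    moreover have "2 * m^3 / (2 * m^3 * D j) = 1 / D j" using m by simp
    ultimately show ?thesis by simp
  qed
  have "(\<Sum>j=1..N. (D j)\<^sup>2) / (2 * m^3) \<le> (real N * m\<^sup>2) / (2 * m^3)"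
    using S m by (intro divide_right_mono) auto
  also have "\<dots> = real N / (2 * m)" using m by (simp add: power2_eq_square power3_eq_cube)
  finally have "real N / m \<le> real N * (3 / (2 * m)) - (\<Sum>j=1..N. (D j)\<^sup>2) / (2 * m^3)"
    by (simp add: field_simps)
  also have "\<dots> = (\<Sum>j=1..N. 3 / (2 * m) - (D j)\<^sup>2 / (2 * m^3))"
    by (simp add: sum_subtractf sum_divide_distrib)
  also have "\<dots> \<le> (\<Sum>j=1..N. 1 / D j)" using tangent by (rule sum_mono)
  finally have "\<eta> * (real N / m) \<le> \<eta> * (\<Sum>j=1..N. 1 / D j)"
    using \<eta> by (intro mult_left_mono) auto
  also have "\<dots> \<le> (\<Sum>j=1..N. lam j)"
    unfolding sum_distrib_left
  proof (rule sum_mono)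
    fix j assume "j \<in> {1..N}"
    then show "\<eta> * (1 / D j) \<le> lam j" using large[of j] D_pos[of j] by (simp add: field_simps)
  qed
  finally have "\<tau> * (\<eta> * (real N / m)) \<le> Lam"
    unfolding Lam_def using \<tau> by (intro mult_left_mono) auto
  moreover have "\<tau> * (\<eta> * (real N / m)) = (real N * \<tau>) powr (3/2) * sqrt (1 - \<sigma>\<^sup>2) * \<eta> / d0"
    using \<tau> \<sigma>_sq by (simp add: m_def q_def powr_three_halves real_sqrt_mult)
  ultimately show ?thesis by simp
qed

lemma Lam_pos: "0 < Lam"
  by (rule less_le_trans[OF _ Lam_lower])
    (use d0_pos \<eta> \<tau> \<sigma>_sq N in \<open>auto intro!: divide_pos_pos mult_pos_pos\<close>)

definition \<alpha> where "\<alpha> j = \<tau> * lam j / Lam"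

lemma \<alpha>_pos: "j \<in> {1..N} \<Longrightarrow> 0 < \<alpha> j"
  using \<tau> lam_pos Lam_pos by (simp add: \<alpha>_def)

lemma sum_\<alpha>: "(\<Sum>j=1..N. \<alpha> j) = 1"
proof -
  have "(\<Sum>j=1..N. \<alpha> j) = Lam / Lam"
    by (simp only: \<alpha>_def Lam_def sum_divide_distrib sum_distrib_left)
  then show ?thesis using Lam_pos by simp
qed

lemma zta_eq: "zta = (\<Sum>j=1..N. \<alpha> j *\<^sub>R zt j)"
  and va_eq: "va = (\<Sum>j=1..N. \<alpha> j *\<^sub>R v j)"
  by (simp_all add: zta_def va_def \<alpha>_def scaleR_sum_right)

text \<open>The weighted deviations of the \<open>zt j\<close> from \<open>zta\<close> add up to
  zero, so pairing them with the constant \<open>va\<close> contributes nothing. This form fits both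
  \<open>telescoped\<close> at \<open>zta\<close> and the ergodic subgradient inequality.\<close>

lemma \<epsilon>a_eq: "\<epsilon>a = (\<Sum>j=1..N. \<alpha> j * (\<epsilon> j + v j \<bullet> (zt j - zta)))"
proof -
  have "(\<Sum>j=1..N. \<alpha> j * ((zt j - zta) \<bullet> va)) = ((\<Sum>j=1..N. \<alpha> j *\<^sub>R zt j) - (\<Sum>j=1..N. \<alpha> j) *\<^sub>R zta) \<bullet> va"
    by (simp add: inner_diff_left inner_sum_left sum_subtractf right_diff_distrib scaleR_left.sum)
  also have "\<dots> = 0" by (simp only: sum_\<alpha> zta_eq) simp
  finally have 0: "(\<Sum>j=1..N. \<alpha> j * ((zt j - zta) \<bullet> va)) = 0" .
  have "\<epsilon>a = (\<Sum>j=1..N. \<alpha> j * (\<epsilon> j + (zt j - zta) \<bullet> (v j - va)))"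
    by (simp add: \<epsilon>a_def \<alpha>_def sum_distrib_left mult_ac)
  also have "\<dots> = (\<Sum>j=1..N. \<alpha> j * (\<epsilon> j + v j \<bullet> (zt j - zta))) - (\<Sum>j=1..N. \<alpha> j * ((zt j - zta) \<bullet> va))"
    by (simp add: sum_subtractf[symmetric] algebra_simps inner_diff inner_commute)
  finally show ?thesis using 0 by simp
qed

lemma Z_telescope: "n \<le> N \<Longrightarrow> (\<Sum>j=1..n. (\<tau> * lam j) *\<^sub>R v j) = Z 0 - Z n"
proof (induction n)
  case (Suc n)
  then show ?case using Z_step[of "Suc n"] by simp
qed simp

lemma divide_Lam_le: "a / Lam \<le> a * d0 / ((real N * \<tau>) powr (3/2) * sqrt (1 - \<sigma>\<^sup>2) * \<eta>)" if "0 \<le> a"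
proof -
  have "0 < (real N * \<tau>) powr (3/2) * sqrt (1 - \<sigma>\<^sup>2) * \<eta> / d0"
    using d0_pos \<eta> \<tau> \<sigma>_sq N by (auto intro!: divide_pos_pos mult_pos_pos)
  then have "a / Lam \<le> a / ((real N * \<tau>) powr (3/2) * sqrt (1 - \<sigma>\<^sup>2) * \<eta> / d0)"
    by (rule divide_left_mono[OF Lam_lower that mult_pos_pos[OF Lam_pos]])
  then show ?thesis by simp
qed

text \<open>The weighted \<open>v j\<close> add up to the total displacement
  \<open>Z 0 - Z N\<close>, and both of its ends lie within \<open>d0\<close> of
  \<open>zs\<close>.\<close>

lemma norm_va: "norm va \<le> 2 * d0\<^sup>2 / ((real N * \<tau>) powr (3/2) * sqrt (1 - \<sigma>\<^sup>2) * \<eta>)"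
proof -
  have "\<tau> *\<^sub>R (\<Sum>j=1..N. lam j *\<^sub>R v j) = Z 0 - Z N"
    using Z_telescope[of N] by (simp add: scaleR_sum_right)
  then have "va = (1 / Lam) *\<^sub>R (Z 0 - Z N)"
    unfolding va_def scaleR_scaleR[symmetric] by simp
  then have "norm va = norm (Z 0 - Z N) / Lam" using Lam_pos by simp
  also have "norm (Z 0 - Z N) \<le> 2 * d0"
    using norm_triangle_ineq4[of "zs - Z N" "zs - Z 0"] Z_dist[of N] Z_dist[of 0] by simp
  also have "2 * d0 / Lam \<le> 2 * d0 * d0 / ((real N * \<tau>) powr (3/2) * sqrt (1 - \<sigma>\<^sup>2) * \<eta>)"
    using d0_pos by (intro divide_Lam_le) auto
  finally show ?thesis using Lam_pos by (simp add: divide_right_mono power2_eq_square mult_ac)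
qed

lemma zta_dist: "norm (zta - zs) \<le> d0 / sqrt (1 - \<sigma>\<^sup>2)"
proof -
  have "zta - zs = (\<Sum>j=1..N. \<alpha> j *\<^sub>R zt j) - (\<Sum>j=1..N. \<alpha> j) *\<^sub>R zs"
    by (simp only: zta_eq sum_\<alpha>) simp
  also have "\<dots> = (\<Sum>j=1..N. \<alpha> j *\<^sub>R (zt j - zs))"
    by (simp add: scaleR_left.sum scaleR_diff_right sum_subtractf)
  finally have "norm (zta - zs) \<le> (\<Sum>j=1..N. norm (\<alpha> j *\<^sub>R (zt j - zs)))"
    by (metis norm_sum)
  also have "\<dots> \<le> (\<Sum>j=1..N. \<alpha> j * (d0 / sqrt (1 - \<sigma>\<^sup>2)))"
  proof (rule sum_mono)
    fix j assume j: "j \<in> {1..N}"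
    have "\<alpha> j * norm (zt j - zs) \<le> \<alpha> j * (d0 / sqrt (1 - \<sigma>\<^sup>2))"
      using zt_dist[OF j] \<alpha>_pos[OF j] by (intro mult_left_mono) auto
    then show "norm (\<alpha> j *\<^sub>R (zt j - zs)) \<le> \<alpha> j * (d0 / sqrt (1 - \<sigma>\<^sup>2))"
      using \<alpha>_pos[OF j] by simp
  qed
  also have "\<dots> = d0 / sqrt (1 - \<sigma>\<^sup>2)"
    by (simp only: sum_distrib_right[symmetric] sum_\<alpha>)
  finally show ?thesis .
qed

text \<open>At \<open>x = zta\<close> the sum in \<open>telescoped\<close> is
  \<open>Lam * \<epsilon>a\<close>, so this quantity is controlled by a difference of squared
  distances from \<open>zta\<close> to the two ends. Centred at \<open>zs\<close>, the squares of
  \<open>p\<close> cancel and only an inner product with \<open>b - a\<close> survives.\<close>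

lemma \<epsilon>a_le: "\<epsilon>a \<le> 2 * d0 ^ 3 / ((real N * \<tau>) powr (3/2) * (1 - \<sigma>\<^sup>2) * \<eta>)"
proof -
  define P where "P = d0 / sqrt (1 - \<sigma>\<^sup>2)"
  define p a b where "p = zta - zs" and "a = Z 0 - zs" and "b = Z N - zs"
  have d0P: "d0 \<le> P"
    using d0_pos \<sigma>_sq \<sigma> by (simp add: P_def pos_le_divide_eq mult_left_le)
  have nb: "norm b \<le> d0" using Z_dist[of N] by (simp add: b_def norm_minus_commute)
  have na: "norm a = d0" by (simp add: a_def d0)
  have np: "norm p \<le> P" using zta_dist by (simp add: p_def P_def)
  have "Lam * \<epsilon>a = (\<Sum>j=1..N. \<tau> * lam j * (\<epsilon> j + v j \<bullet> (zt j - zta)))"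
    using Lam_pos by (simp add: \<epsilon>a_eq \<alpha>_def sum_distrib_left)
  with telescoped[of N zta]
  have "(norm (zta - Z N))\<^sup>2 + 2 * (Lam * \<epsilon>a) + \<tau> * (1 - \<sigma>\<^sup>2) * (\<Sum>j=1..N. (D j)\<^sup>2) \<le> (norm (zta - Z 0))\<^sup>2"
    by simp
  moreover have "0 \<le> \<tau> * (1 - \<sigma>\<^sup>2) * (\<Sum>j=1..N. (D j)\<^sup>2)"
    using \<tau> \<sigma>_sq by (intro mult_nonneg_nonneg sum_nonneg) auto
  moreover have "zta - Z 0 = p - a" "zta - Z N = p - b" by (auto simp: p_def a_def b_def)
  ultimately have "2 * (Lam * \<epsilon>a) \<le> (norm (p - a))\<^sup>2 - (norm (p - b))\<^sup>2" by simp
  also have "\<dots> = 2 * (p \<bullet> (b - a)) + (norm a)\<^sup>2 - (norm b)\<^sup>2"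
    unfolding power2_norm_eq_inner by (simp add: inner_diff inner_commute algebra_simps)
  also have "\<dots> \<le> 2 * (P * (norm b + d0)) + d0\<^sup>2 - (norm b)\<^sup>2"
  proof -
    have "p \<bullet> (b - a) \<le> norm p * norm (b - a)" by (rule norm_cauchy_schwarz)
    also have "\<dots> \<le> P * (norm b + d0)"
      using np norm_triangle_ineq4[of b a] na d0P d0_pos by (intro mult_mono) auto
    finally show ?thesis using na by simp
  qed
  \<comment> \<open>As a function of \<open>norm b\<close> the bound increases up to
    \<open>P\<close>, and \<open>norm b \<le> d0 \<le> P\<close>; the worst case is
    \<open>norm b = d0\<close>.\<close>
  also have "\<dots> \<le> 4 * (P * d0)"
  proof -
    have "0 \<le> (d0 - norm b) * (2 * P - d0 - norm b)"
      using nb d0P by (intro mult_nonneg_nonneg) auto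
    then show ?thesis by (simp add: algebra_simps power2_eq_square)
  qed
  finally have "Lam * \<epsilon>a \<le> 2 * (P * d0)" by simp
  then have "\<epsilon>a \<le> 2 * (P * d0) / Lam"
    using Lam_pos by (subst pos_le_divide_eq) (auto simp: mult_ac)
  also have "\<dots> \<le> 2 * (P * d0) * d0 / ((real N * \<tau>) powr (3/2) * sqrt (1 - \<sigma>\<^sup>2) * \<eta>)"
    using d0P d0_pos by (intro divide_Lam_le) auto
  also have "\<dots> = 2 * d0 ^ 3 / ((real N * \<tau>) powr (3/2) * (sqrt (1 - \<sigma>\<^sup>2) * sqrt (1 - \<sigma>\<^sup>2)) * \<eta>)"
    by (simp add: P_def power3_eq_cube mult_ac)
  finally show ?thesis using \<sigma>_sq by simp
qed

end

section \<open>Saddle operator, residual and neighbourhoods\<close>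

lemma h_root_properties:
  assumes "0 < \<sigma>" "0 < \<theta>" "\<theta> < 1"
  shows "0 < h_root \<sigma> \<theta>"
    and "\<theta> * (1 + h_root \<sigma> \<theta>) * (1 + h_root \<sigma> \<theta> * (1 + 1 / \<sigma>))\<^sup>2 = 1"
proof -
  define P where "P h = \<theta> * (1 + h) * (1 + h * (1 + 1 / \<sigma>))\<^sup>2" for h
  have mono: "P a < P b" if "0 \<le> a" "a < b" for a b
  proof -
    have s: "0 < 1 + 1 / \<sigma>" using assms by (simp add: add_pos_pos)
    have "a * (1 + 1 / \<sigma>) < b * (1 + 1 / \<sigma>)" using that s by (intro mult_strict_right_mono)
    moreover have "0 \<le> a * (1 + 1 / \<sigma>)" using that s by simp
    ultimately show ?thesis
      unfolding P_def using that assms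
      by (intro mult_strict_mono power_strict_mono mult_strict_left_mono) (auto intro: add_pos_nonneg)
  qed
  have "P 0 \<le> 1" using assms by (simp add: P_def)
  \<comment> \<open>The right end point for the intermediate value theorem: already
    \<open>\<theta> * (1 + 1 / \<theta>) = \<theta> + 1\<close> exceeds 1.\<close>
  moreover have "1 \<le> P (1 / \<theta>)"
  proof -
    have "1 \<le> \<theta> * (1 + 1 / \<theta>)" using assms by (simp add: field_simps)
    moreover have "1 \<le> (1 + 1 / \<theta> * (1 + 1 / \<sigma>))\<^sup>2" using assms by (intro one_le_power) simp
    ultimately show ?thesis unfolding P_def by (metis mult_mono' mult_1 zero_le_one)
  qed
  moreover have "continuous_on {0..1 / \<theta>} P" unfolding P_def by (intro continuous_intros)
  ultimately obtain h where h: "0 \<le> h" "P h = 1"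
    using IVT'[of P 0 1 "1 / \<theta>"] assms by auto
  have "h \<noteq> 0" using h assms by (auto simp: P_def)
  then have "0 < h \<and> P h = 1" using h by simp
  moreover have "h' = h" if "0 < h' \<and> P h' = 1" for h'
    using that h mono[of h h'] mono[of h' h] by (cases h h' rule: linorder_cases) auto
  ultimately have "0 < h_root \<sigma> \<theta> \<and> P (h_root \<sigma> \<theta>) = 1"
    unfolding h_root_def P_def[symmetric] by (rule theI)
  then show "0 < h_root \<sigma> \<theta>" "\<theta> * (1 + h_root \<sigma> \<theta>) * (1 + h_root \<sigma> \<theta> * (1 + 1 / \<sigma>))\<^sup>2 = 1"
    by (auto simp: P_def)
qed

lemma inner_mono_vec:
  fixes a b c :: "real^'m"
  assumes "0 \<le> a" "b \<le> c"
  shows "a \<bullet> b \<le> a \<bullet> c"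
  using assms by (auto simp: inner_vec_def less_eq_vec_def intro!: sum_mono mult_left_mono)

lemma inner_nonneg_vec: "0 \<le> a \<Longrightarrow> 0 \<le> b \<Longrightarrow> 0 \<le> a \<bullet> b" for a b :: "real^'m"
  using inner_mono_vec[of a 0 b] by simp

lemma abs_vec_nonneg: "0 \<le> y \<Longrightarrow> \<bar>y\<bar> = y" for y :: "real^'m"
  by (simp add: vec_eq_iff less_eq_vec_def)

lemma neg_part_nonneg: "0 \<le> neg_part y"
  by (simp add: neg_part_def less_eq_vec_def)

lemma gradmat_mult: "gradmat g x *v y = (\<Sum>i\<in>UNIV. y $ i *\<^sub>R grad (\<lambda>u. g u $ i) x)"
  by (simp add: vec_eq_iff gradmat_def matrix_vector_mult_def mult.commute)

lemma continuous_on_compose_fst: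
  fixes h :: "'a::t2_space \<Rightarrow> 'b::topological_space"
  assumes "\<And>x. isCont h x"
  shows "continuous_on UNIV (\<lambda>z::'a \<times> 'c::topological_space. h (fst z))"
  by (rule continuous_on_compose2[of UNIV h])
    (auto intro!: continuous_at_imp_continuous_on assms continuous_on_fst continuous_on_id)

locale convex_problem =
  fixes f :: "real^'n \<Rightarrow> real" and g :: "real^'n \<Rightarrow> real^'m" and L0 :: real and Lg :: "real^'m"
  assumes standing: "standing_assumptions f g L0 Lg"
begin

sublocale f: lipschitz_hessian f L0
  using standing by unfold_locales (auto simp: standing_assumptions_def)

sublocale g: lipschitz_hessian "\<lambda>x. g x $ i" "Lg $ i" for i
  using standing by unfold_locales (auto simp: standing_assumptions_def)

lemma convex_f: "convex_on UNIV f" and convex_g: "convex_on UNIV (\<lambda>x. g x $ i)"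
  and KKT_nonempty: "KKT f g \<noteq> {}"
  using standing by (auto simp: standing_assumptions_def)

lemma Lg_nonneg: "0 \<le> Lg" and norm_Lg_pos: "0 < norm Lg"
  using standing g.L_nonneg by (auto simp: standing_assumptions_def less_eq_vec_def)

abbreviation gradL where "gradL x y \<equiv> grad f x + gradmat g x *v y"

lemma gradL_inner: "gradL x y \<bullet> d = grad f x \<bullet> d + (\<Sum>i\<in>UNIV. y $ i * (grad (\<lambda>u. g u $ i) x \<bullet> d))"
  by (simp add: gradmat_mult inner_add_left inner_sum_left)

lemma lagrangian_above_tangent:
  assumes "0 \<le> y"
  shows "f x + y \<bullet> g x + gradL x y \<bullet> (x' - x) \<le> f x' + y \<bullet> g x'"
proof -
  have "(\<Sum>i\<in>UNIV. y $ i * (g x $ i + grad (\<lambda>u. g u $ i) x \<bullet> (x' - x))) \<le> (\<Sum>i\<in>UNIV. y $ i * g x' $ i)"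
    using assms convex_above_tangent[OF convex_g g.deriv_f]
    by (intro sum_mono mult_left_mono) (auto simp: less_eq_vec_def)
  moreover have "f x + grad f x \<bullet> (x' - x) \<le> f x'"
    by (rule convex_above_tangent[OF convex_f f.deriv_f])
  ultimately show ?thesis
    by (simp add: gradL_inner inner_vec_def[of y] distrib_left sum.distrib)
qed

text \<open>The Lagrangian is affine in \<open>y\<close>, so only \<open>x\<close> needs a tangent
  inequality. Pairing \<open>- w\<close> with \<open>y' - snd z\<close> gives
  \<open>snd z \<bullet> w\<close>, which the subtracted error cancels, and
  \<open>- (w \<bullet> y')\<close>, which is nonpositive.\<close>

lemma saddle_gap:
  assumes "0 \<le> snd z" "0 \<le> w" "0 \<le> y'"
  shows "(opS f g z - (0, w)) \<bullet> ((x', y') - z) - snd z \<bullet> w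
    \<le> f x' + snd z \<bullet> g x' - (f (fst z) + y' \<bullet> g (fst z))"
proof -
  obtain x y where z: "z = (x, y)" by (cases z)
  have "0 \<le> w \<bullet> y'" using assms by (intro inner_nonneg_vec)
  then show ?thesis using lagrangian_above_tangent[of y x x'] assms
    by (simp add: z opS_def inner_diff inner_commute[of w] inner_commute[of "g _"] algebra_simps)
qed

text \<open>\<open>saddle_gap\<close> is tested at \<open>zs\<close>: a KKT point is a saddle point
  of the Lagrangian, so the right-hand side there is nonpositive.\<close>

lemma KKT_monotone:
  assumes "zs \<in> KKT f g" "0 \<le> snd z" "0 \<le> w"
  shows "0 \<le> snd z \<bullet> w + (opS f g z - (0, w)) \<bullet> (z - zs)"
proof -
  obtain xs ys where zs: "zs = (xs, ys)" by (cases zs)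
  have K: "gradL xs ys = 0" "g xs \<le> 0" "0 \<le> ys" "ys \<bullet> g xs = 0"
    using assms(1) by (auto simp: zs KKT_def)
  have "f xs \<le> f (fst z) + ys \<bullet> g (fst z)"
    using lagrangian_above_tangent[OF K(3), of xs "fst z"] K by simp
  moreover have "snd z \<bullet> g xs \<le> 0"
    using inner_mono_vec[OF assms(2) K(2)] by simp
  moreover have "(opS f g z - (0, w)) \<bullet> (z - zs) = - ((opS f g z - (0, w)) \<bullet> ((xs, ys) - z))"
    by (simp only: zs inner_diff_right)
  ultimately show ?thesis using saddle_gap[OF assms(2,3) K(3), of xs] by linarith
qed

text \<open>Closedness makes the distance \<open>d0\<close> attained, which provides the reference
  solution \<open>zs\<close> of the HPE analysis.\<close>

lemma closed_KKT: "closed (KKT f g)"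
proof -
  have cg: "continuous_on UNIV (\<lambda>z::(real^'n) \<times> (real^'m). g (fst z) $ i)"
    and cgf: "continuous_on UNIV (\<lambda>z::(real^'n) \<times> (real^'m). grad f (fst z))"
    and cgg: "continuous_on UNIV (\<lambda>z::(real^'n) \<times> (real^'m). grad (\<lambda>u. g u $ i) (fst z))" for i
    by (rule continuous_on_compose_fst, rule has_derivative_continuous,
        rule g.deriv_f f.deriv_grad g.deriv_grad)+
  have "KKT f g = {z. gradL (fst z) (snd z) = 0} \<inter> {z. \<forall>i. g (fst z) $ i \<le> 0}
      \<inter> {z. \<forall>i. 0 \<le> snd z $ i} \<inter> {z. snd z \<bullet> g (fst z) = 0}"
    by (auto simp: KKT_def less_eq_vec_def)
  moreover have "closed {z. gradL (fst z) (snd z) = 0}"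
    unfolding gradmat_mult by (intro closed_Collect_eq continuous_intros cgf cgg)
  moreover have "closed {z::(real^'n) \<times> (real^'m). \<forall>i. g (fst z) $ i \<le> 0}"
    by (intro closed_Collect_all closed_Collect_le continuous_on_const cg)
  moreover have "closed {z::(real^'n) \<times> (real^'m). \<forall>i. 0 \<le> snd z $ i}"
    by (intro closed_Collect_all closed_Collect_le continuous_intros)
  moreover have "continuous_on UNIV (\<lambda>z. snd z $ i * g (fst z) $ i)" for i
    by (rule continuous_on_mult[OF _ cg]) (intro continuous_intros)
  then have "closed {z. snd z \<bullet> g (fst z) = 0}"
    unfolding inner_vec_def inner_real_def
    by (intro closed_Collect_eq continuous_on_sum continuous_on_const)
  ultimately show ?thesis by (auto intro: closed_Int)
qed

section \<open>The proximal residual and the quadratic that defines \<open>rho\<close>\<close>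

abbreviation Psi_obj where
  "Psi_obj z0 lam z w \<equiv> (norm (lam *\<^sub>R (opS f g z - (0, w)) + z - z0))\<^sup>2 + 2 * lam * (snd z \<bullet> w)"

lemma Psi_obj_nonneg:
  assumes "0 \<le> lam" "0 \<le> snd z" "0 \<le> w"
  shows "0 \<le> Psi_obj z0 lam z w"
  using assms inner_nonneg_vec[of "snd z" w] by simp

lemma Psi_le:
  assumes "0 \<le> lam" "0 \<le> snd z" "0 \<le> w"
  shows "Psi f g z0 lam z \<le> Psi_obj z0 lam z w"
  unfolding Psi_def
proof (rule cINF_lower)
  show "bdd_below ((\<lambda>w. Psi_obj z0 lam z w) ` {0..})"
    using Psi_obj_nonneg[OF assms(1,2)] by (intro bdd_belowI2[where m = 0]) auto
qed (use assms in simp)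

text \<open>Up to a term independent of \<open>w\<close>, the objective is \<open>\<parallel>b - lam *\<^sub>R w\<parallel>\<^sup>2\<close> with
  \<open>b = - (lam *\<^sub>R g x + y\<^sub>0)\<close>.\<close>

lemma Psi_eq:
  assumes "0 < lam" "0 \<le> snd z"
  shows "Psi f g z0 lam z = Psi_obj z0 lam z (neg_part (g (fst z) + inverse lam *\<^sub>R snd z0))"
proof (rule antisym)
  show "Psi f g z0 lam z \<le> Psi_obj z0 lam z (neg_part (g (fst z) + inverse lam *\<^sub>R snd z0))"
    using assms by (intro Psi_le neg_part_nonneg) auto
  obtain x y where z: "z = (x, y)" by (cases z)
  obtain x0 y0 where z0: "z0 = (x0, y0)" by (cases z0)
  define b where "b = - (lam *\<^sub>R g x + y0)"
  define w1 where "w1 = neg_part (g x + inverse lam *\<^sub>R y0)"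
  have obj: "Psi_obj z0 lam z w = (norm (lam *\<^sub>R gradL x y + x - x0))\<^sup>2
      + (norm (b - lam *\<^sub>R w))\<^sup>2 + 2 * (y \<bullet> b) + (norm y)\<^sup>2" for w
  proof -
    have "lam *\<^sub>R (opS f g z - (0, w)) + z - z0 = (lam *\<^sub>R gradL x y + x - x0, (b - lam *\<^sub>R w) + y)"
      by (simp add: z z0 opS_def b_def algebra_simps)
    moreover have "(norm ((b - lam *\<^sub>R w) + y))\<^sup>2
        = (norm (b - lam *\<^sub>R w))\<^sup>2 + 2 * (y \<bullet> (b - lam *\<^sub>R w)) + (norm y)\<^sup>2"
      unfolding power2_norm_eq_inner by (simp add: inner_add inner_commute)
    ultimately show ?thesis
      by (simp add: norm_Pair z inner_diff_right algebra_simps)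
  qed
  have "Psi_obj z0 lam z w1 \<le> Psi_obj z0 lam z w" if w: "0 \<le> w" for w
  proof -
    have "norm (b - lam *\<^sub>R w1) \<le> norm (b - lam *\<^sub>R w)"
    proof (rule norm_le_componentwise_cart)
      fix i
      have "lam * (w1 $ i) = max (b $ i) 0"
        using assms(1) by (simp add: w1_def neg_part_def b_def max_def field_simps)
      moreover have "0 \<le> lam * (w $ i)" using w assms(1) by (simp add: less_eq_vec_def)
      ultimately show "norm ((b - lam *\<^sub>R w1) $ i) \<le> norm ((b - lam *\<^sub>R w) $ i)" by auto
    qed
    then show ?thesis unfolding obj by (simp add: power_mono)
  qed
  then show "Psi_obj z0 lam z (neg_part (g (fst z) + inverse lam *\<^sub>R snd z0)) \<le> Psi f g z0 lam z"
    unfolding Psi_def by (intro cINF_greatest) (auto simp: z z0 w1_def)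
qed

lemma Psi_nonneg: "0 < lam \<Longrightarrow> 0 \<le> snd z \<Longrightarrow> 0 \<le> Psi f g z0 lam z"
  unfolding Psi_eq by (intro Psi_obj_nonneg neg_part_nonneg) auto

abbreviation B where "B y \<equiv> (L0 + Lg \<bullet> \<bar>y\<bar>) / 2"

lemma B_nonneg: "0 \<le> B y"
proof -
  have "0 \<le> \<bar>y\<bar>" by (rule abs_ge_zero)
  then show ?thesis using f.L_nonneg inner_nonneg_vec[OF Lg_nonneg] by (simp add: add_nonneg_nonneg)
qed

lemma B_lipschitz: "B y \<le> B y' + norm Lg * norm (y - y') / 2"
proof -
  have "Lg \<bullet> \<bar>y\<bar> - Lg \<bullet> \<bar>y'\<bar> \<le> norm Lg * norm (\<bar>y\<bar> - \<bar>y'\<bar>)"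
    unfolding inner_diff_right[symmetric] by (rule norm_cauchy_schwarz)
  also have "\<dots> \<le> norm Lg * norm (y - y')"
    by (intro mult_left_mono norm_le_componentwise_cart) (auto simp: abs_vec_def)
  finally have "Lg \<bullet> \<bar>y\<bar> \<le> Lg \<bullet> \<bar>y'\<bar> + norm Lg * norm (y - y')" by linarith
  then show ?thesis by (simp add: add_divide_distrib)
qed

lemma quad_bound_nonneg: "0 \<le> r \<Longrightarrow> 0 \<le> quad_bound L0 Lg y r"
  using B_nonneg[of y] by (simp add: quad_bound_def)

text \<open>Strictness holds even where \<open>B y\<close> vanishes, because
  \<open>norm_Lg_pos\<close> makes the quadratic coefficient positive.\<close>

lemma quad_bound_less: "0 \<le> r \<Longrightarrow> r < s \<Longrightarrow> quad_bound L0 Lg y r < quad_bound L0 Lg y s"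
  unfolding quad_bound_def using B_nonneg[of y] norm_Lg_pos
  by (intro mult_strict_mono add_le_less_mono mult_strict_left_mono add_nonneg_pos) auto

lemma quad_bound_mono: "0 \<le> r \<Longrightarrow> r \<le> s \<Longrightarrow> quad_bound L0 Lg y r \<le> quad_bound L0 Lg y s"
  using quad_bound_less[of r s y] by (cases "r = s") auto

text \<open>The quadratic has no constant term, and its linear term grows by \<open>a\<close>, which
  is at most \<open>a\<^sup>2\<close>. This is the origin of the square in the equation for
  \<open>h_root\<close>.\<close>

lemma quad_bound_scale:
  assumes "0 \<le> r" "1 \<le> a"
  shows "quad_bound L0 Lg y (a * r) \<le> a\<^sup>2 * quad_bound L0 Lg y r"
proof -
  have "1 * B y \<le> a * B y" using assms B_nonneg[of y] by (intro mult_right_mono)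
  then have "a * B y \<le> a * (a * B y)" using assms by (intro mult_left_mono) auto
  then have "a * B y * r \<le> a * (a * B y) * r" using assms by (intro mult_right_mono)
  then show ?thesis unfolding quad_bound_def by (simp add: algebra_simps power2_eq_square)
qed

lemma rho_root:
  assumes "0 < \<alpha>"
  shows "0 < rho L0 Lg y \<alpha>" "quad_bound L0 Lg y (rho L0 Lg y \<alpha>) = \<alpha>"
proof -
  have c: "continuous_on {0..b} (quad_bound L0 Lg y)" for b
    unfolding quad_bound_def by (intro continuous_intros)
  define C where "C = 2 * norm Lg / 3"
  have C: "0 < C" using norm_Lg_pos by (simp add: C_def)
  \<comment> \<open>With \<open>b \<ge> 1\<close> and \<open>C * b \<ge> \<alpha>\<close> the
    quadratic term alone reaches \<open>\<alpha>\<close> at \<open>b\<close>.\<close>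
  define b where "b = 1 + \<alpha> / C"
  have b: "1 \<le> b" "\<alpha> \<le> C * b" using assms C by (auto simp: b_def field_simps)
  have "\<alpha> \<le> B y + C * b" using b B_nonneg[of y] by linarith
  then have "\<alpha> * 1 \<le> (B y + C * b) * b" using b assms by (intro mult_mono) auto
  then have "\<alpha> \<le> quad_bound L0 Lg y b" unfolding quad_bound_def C_def[symmetric] by simp
  then obtain r where r: "0 \<le> r" "quad_bound L0 Lg y r = \<alpha>"
    using IVT'[of "quad_bound L0 Lg y" 0 \<alpha> b] b c[of b] assms by (auto simp: quad_bound_def)
  have "rho L0 Lg y \<alpha> = r" unfolding rho_def
  proof (rule Greatest_equality)
    fix s assume "quad_bound L0 Lg y s = \<alpha>"
    then show "s \<le> r" using quad_bound_less[of r s y] r by force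
  qed (rule r)
  moreover have "r \<noteq> 0" using r assms by (auto simp: quad_bound_def)
  ultimately show "0 < rho L0 Lg y \<alpha>" "quad_bound L0 Lg y (rho L0 Lg y \<alpha>) = \<alpha>" using r by auto
qed

lemma le_rho: "0 < \<alpha> \<Longrightarrow> quad_bound L0 Lg y r \<le> \<alpha> \<Longrightarrow> r \<le> rho L0 Lg y \<alpha>"
  using quad_bound_less[of "rho L0 Lg y \<alpha>" r y] rho_root[of \<alpha> y] by force

end

section \<open>The Newton step\<close>

text \<open>First-order optimality: the maximum is compared with its value at
  \<open>y + t *\<^sub>R d\<close>, the inequality is divided by \<open>t\<close>, and the quadratic
  term disappears as \<open>t\<close> tends to 0.\<close>

lemma inner_concave_maximizer:
  fixes y y0 b :: "'a::real_inner"
  assumes max: "\<And>y'. y' \<in> Y \<Longrightarrow>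
      y' \<bullet> b - (norm (y' - y0))\<^sup>2 / (2 * lam) \<le> y \<bullet> b - (norm (y - y0))\<^sup>2 / (2 * lam)"
    and "convex Y" "y \<in> Y" "y' \<in> Y" "0 < lam"
  shows "0 \<le> (y' - y) \<bullet> ((1 / lam) *\<^sub>R (y - y0) - b)"
proof -
  define d where "d = y' - y"
  have "- (t * (norm d)\<^sup>2 / (2 * lam)) \<le> d \<bullet> ((1 / lam) *\<^sub>R (y - y0) - b)" if "0 < t" "t < 1" for t
  proof -
    have "y + t *\<^sub>R d = (1 - t) *\<^sub>R y + t *\<^sub>R y'" by (simp add: d_def algebra_simps)
    then have "y + t *\<^sub>R d \<in> Y"
      using convexD_alt[OF assms(2-4), of t] that by simp
    then have "t * (d \<bullet> b) \<le> ((norm (y + t *\<^sub>R d - y0))\<^sup>2 - (norm (y - y0))\<^sup>2) / (2 * lam)"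
      using max[of "y + t *\<^sub>R d"] by (simp add: inner_add_left diff_divide_distrib)
    also have "(norm (y + t *\<^sub>R d - y0))\<^sup>2 = (norm (y - y0))\<^sup>2 + 2 * t * (d \<bullet> (y - y0)) + t\<^sup>2 * (norm d)\<^sup>2"
      unfolding power2_norm_eq_inner
      by (simp add: inner_add inner_diff inner_commute algebra_simps power2_eq_square)
    finally have "t * (d \<bullet> b) \<le> t * ((2 * (d \<bullet> (y - y0)) + t * (norm d)\<^sup>2) / (2 * lam))"
      by (simp add: algebra_simps power2_eq_square)
    then have "d \<bullet> b \<le> (2 * (d \<bullet> (y - y0)) + t * (norm d)\<^sup>2) / (2 * lam)"
      using that(1) by (rule mult_left_le_imp_le)
    moreover have "2 * (d \<bullet> (y - y0)) / (2 * lam) = d \<bullet> (y - y0) / lam" by simp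
    ultimately show ?thesis
      unfolding inner_diff_right[of _ _ b] inner_scaleR_right add_divide_distrib by simp
  qed
  then have "eventually (\<lambda>t. - (t * (norm d)\<^sup>2 / (2 * lam)) \<le> d \<bullet> ((1 / lam) *\<^sub>R (y - y0) - b)) (at_right 0)"
    by (auto simp: eventually_at_right[of 0 1] intro!: exI[of _ 1])
  moreover have "((\<lambda>t. - (t * (norm d)\<^sup>2 / (2 * lam))) \<longlongrightarrow> - (0 * (norm d)\<^sup>2 / (2 * lam))) (at_right 0)"
    using assms(5) by (intro tendsto_intros) auto
  ultimately have "- (0 * (norm d)\<^sup>2 / (2 * lam)) \<le> d \<bullet> ((1 / lam) *\<^sub>R (y - y0) - b)"
    by (intro tendsto_upperbound[of _ _ "at_right 0"]) auto
  then show ?thesis by (simp add: d_def)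
qed

context convex_problem
begin

abbreviation mgrad_f where "mgrad_f a x \<equiv> grad f a + f.H a (x - a)"
abbreviation mgrad_g where "mgrad_g a i x \<equiv> grad (\<lambda>u. g u $ i) a + g.H i a (x - a)"
abbreviation mgradL where
  "mgradL a x y \<equiv> mgrad_f a x + (\<Sum>i\<in>UNIV. y $ i *\<^sub>R mgrad_g a i x)"
abbreviation mL where "mL a x y \<equiv> taylor2 f a x + y \<bullet> taylor2_vec g a x"

lemma mL_above_tangent:
  assumes "0 \<le> y"
  shows "mL a x y + mgradL a x y \<bullet> (x' - x) \<le> mL a x' y"
proof -
  have "(\<Sum>i\<in>UNIV. y $ i * (taylor2 (\<lambda>u. g u $ i) a x + mgrad_g a i x \<bullet> (x' - x)))
      \<le> (\<Sum>i\<in>UNIV. y $ i * taylor2 (\<lambda>u. g u $ i) a x')"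
    using assms g.taylor2_above_tangent[OF convex_g]
    by (intro sum_mono mult_left_mono) (auto simp: less_eq_vec_def)
  then show ?thesis
    using f.taylor2_above_tangent[OF convex_f, of a x x']
    by (simp add: inner_vec_def[of y] taylor2_vec_def distrib_left sum.distrib inner_add_left
        inner_sum_left)
qed

text \<open>Danskin's argument without differentiating the supremum: by strong concavity in \<open>y\<close> the partial
  supremum lies below \<open>G x' = F x' y + lam / 2 * \<parallel>g\<^sub>a x' - g\<^sub>a x\<parallel>\<^sup>2\<close>, which has the same value at
  the minimiser \<open>x\<close> and there the gradient of \<open>F \<cdot> y\<close>.\<close>

lemma minmax_optimality:
  assumes lam: "0 < lam"
    and sol: "minmax_solution (reg_lagrangian f g a z0 lam) {0..} (x, y)"
  shows "0 \<le> y"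
    and "lam *\<^sub>R mgradL a x y + x - fst z0 = 0"
    and "\<And>y'. 0 \<le> y' \<Longrightarrow> 0 \<le> (y' - y) \<bullet> ((1 / lam) *\<^sub>R (y - snd z0) - taylor2_vec g a x)"
proof -
  obtain x0 y0 where z0: "z0 = (x0, y0)" by (cases z0)
  let ?F = "reg_lagrangian f g a z0 lam"
  let ?T = "taylor2_vec g a"
  have F: "?F x y = taylor2 f a x + y \<bullet> ?T x + ((norm (x - x0))\<^sup>2 - (norm (y - y0))\<^sup>2) / (2 * lam)" for x y
    by (simp add: reg_lagrangian_def z0)
  have xmin: "(SUP y'\<in>{0..}. ?F x y') \<le> (SUP y'\<in>{0..}. ?F x' y')" for x'
    using sol by (auto simp: minmax_solution_def is_arg_min_def not_less)
  have ymax: "0 \<le> y" "\<And>y'. 0 \<le> y' \<Longrightarrow> ?F x y' \<le> ?F x y"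
    using sol by (auto simp: minmax_solution_def is_arg_max_def not_less)
  show "0 \<le> y" by (rule ymax)
  have conv: "convex {0::real^'m..}"
    by (auto simp: convex_def less_eq_vec_def)
  show opt: "0 \<le> (y' - y) \<bullet> ((1 / lam) *\<^sub>R (y - snd z0) - ?T x)" if "0 \<le> y'" for y'
    unfolding z0 snd_conv
  proof (rule inner_concave_maximizer[OF _ conv _ _ lam])
    show "u \<bullet> ?T x - (norm (u - y0))\<^sup>2 / (2 * lam) \<le> y \<bullet> ?T x - (norm (y - y0))\<^sup>2 / (2 * lam)"
      if "u \<in> {0..}" for u
      using ymax(2)[of u] that by (simp add: F diff_divide_distrib)
  qed (use that ymax in auto)
  define G where "G x' = ?F x' y + lam / 2 * (norm (?T x' - ?T x))\<^sup>2" for x'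
  have le_G: "?F x' y' \<le> G x'" if y': "0 \<le> y'" for x' y'
  proof -
    define d where "d = y' - y"
    have "?F x' y' - ?F x' y = d \<bullet> ?T x' - ((norm (y' - y0))\<^sup>2 - (norm (y - y0))\<^sup>2) / (2 * lam)"
      by (simp add: F d_def inner_diff_left diff_divide_distrib)
    also have "(norm (y' - y0))\<^sup>2 = (norm (y - y0))\<^sup>2 + 2 * (d \<bullet> (y - y0)) + (norm d)\<^sup>2"
      unfolding power2_norm_eq_inner d_def by (simp add: inner_diff inner_commute)
    finally have "?F x' y' - ?F x' y
        = d \<bullet> ?T x' - d \<bullet> ((1 / lam) *\<^sub>R (y - y0)) - (norm d)\<^sup>2 / (2 * lam)"
      unfolding inner_scaleR_right by (simp add: add_divide_distrib)
    also have "\<dots> \<le> d \<bullet> (?T x' - ?T x) - (norm d)\<^sup>2 / (2 * lam)"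
      using opt[OF y'] by (simp add: z0 d_def inner_diff_right)
    also have "\<dots> \<le> norm d * norm (?T x' - ?T x) - (norm d)\<^sup>2 / (2 * lam)"
      by (simp add: norm_cauchy_schwarz)
    also have "\<dots> \<le> lam / 2 * (norm (?T x' - ?T x))\<^sup>2"
    proof -
      have "0 \<le> (norm d - lam * norm (?T x' - ?T x))\<^sup>2 / (2 * lam)" using lam by simp
      also have "\<dots> = (norm d)\<^sup>2 / (2 * lam) - norm d * norm (?T x' - ?T x)
          + lam / 2 * (norm (?T x' - ?T x))\<^sup>2"
        using lam by (simp add: power2_diff field_simps power2_eq_square)
      finally show ?thesis by linarith
    qed
    finally show ?thesis by (simp add: G_def)
  qed
  have "G x \<le> G x'" for x'
  proof -
    have "G x = ?F x y" by (simp add: G_def)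
    \<comment> \<open>A supremum of reals is meaningful only for bounded sets; \<open>le_G\<close>
      provides the bound along with the comparison.\<close>
    also have "\<dots> \<le> (SUP y'\<in>{0..}. ?F x y')"
      using ymax le_G by (intro cSUP_upper bdd_aboveI2[where M = "G x"]) auto
    also have "\<dots> \<le> (SUP y'\<in>{0..}. ?F x' y')" by (rule xmin)
    also have "\<dots> \<le> G x'" using le_G by (intro cSUP_least) auto
    finally show ?thesis .
  qed
  moreover have "(G has_derivative (\<lambda>h. (mgradL a x y + (1 / lam) *\<^sub>R (x - x0)) \<bullet> h)) (at x)"
  proof -
    have T: "y \<bullet> ?T x' = (\<Sum>i\<in>UNIV. y $ i * taylor2 (\<lambda>u. g u $ i) a x')"
      "(norm (?T x' - ?T x))\<^sup>2
        = (\<Sum>i\<in>UNIV. (taylor2 (\<lambda>u. g u $ i) a x' - taylor2 (\<lambda>u. g u $ i) a x)\<^sup>2)" for x'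
      unfolding power2_norm_eq_inner by (simp_all add: inner_vec_def taylor2_vec_def power2_eq_square)
    have dC: "((\<lambda>x'. ((norm (x' - x0))\<^sup>2 - (norm (y - y0))\<^sup>2) / (2 * lam)) has_derivative
        (\<lambda>h. 2 * ((x - x0) \<bullet> h) / (2 * lam))) (at x)"
      unfolding power2_norm_eq_inner divide_inverse
      by (auto intro!: derivative_eq_intros simp: inner_commute)
    have "((\<lambda>x'. (taylor2 (\<lambda>u. g u $ i) a x' - taylor2 (\<lambda>u. g u $ i) a x)\<^sup>2)
        has_derivative (\<lambda>h. 0)) (at x)" for i
      by (rule has_derivative_eq_rhs[OF has_derivative_power[OF
            has_derivative_diff[OF g.taylor2_has_derivative has_derivative_const]]]) simp
    then have dD: "((\<lambda>x'. lam / 2 *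
        (\<Sum>i\<in>UNIV. (taylor2 (\<lambda>u. g u $ i) a x' - taylor2 (\<lambda>u. g u $ i) a x)\<^sup>2))
        has_derivative (\<lambda>h. lam / 2 * (\<Sum>i\<in>(UNIV::'m set). 0))) (at x)"
      by (intro has_derivative_mult_right has_derivative_sum)
    have dB: "((\<lambda>x'. \<Sum>i\<in>UNIV. y $ i * taylor2 (\<lambda>u. g u $ i) a x')
        has_derivative (\<lambda>h. \<Sum>i\<in>UNIV. y $ i * (mgrad_g a i x \<bullet> h))) (at x)"
      by (intro has_derivative_sum has_derivative_mult_right g.taylor2_has_derivative)
    have "(G has_derivative (\<lambda>h. mgrad_f a x \<bullet> h + (\<Sum>i\<in>UNIV. y $ i * (mgrad_g a i x \<bullet> h))
        + 2 * ((x - x0) \<bullet> h) / (2 * lam) + lam / 2 * (\<Sum>i\<in>(UNIV::'m set). 0))) (at x)"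
      unfolding G_def[abs_def] F T
      by (rule has_derivative_add[OF has_derivative_add[OF
            has_derivative_add[OF f.taylor2_has_derivative dB] dC] dD])
    then show ?thesis
      by (rule has_derivative_eq_rhs)
        (simp add: fun_eq_iff inner_add_left inner_sum_left)
  qed
  ultimately have "(\<lambda>h. (mgradL a x y + (1 / lam) *\<^sub>R (x - x0)) \<bullet> h) = (\<lambda>h. 0)"
    by (intro differential_zero_maxmin[of x UNIV G]) auto
  from fun_cong[OF this, of "mgradL a x y + (1 / lam) *\<^sub>R (x - x0)"]
  have "mgradL a x y + (1 / lam) *\<^sub>R (x - x0) = 0"
    by (simp only: inner_eq_zero_iff)
  then have "lam *\<^sub>R (mgradL a x y + (1 / lam) *\<^sub>R (x - x0)) = 0" by (simp only: scaleR_zero_right)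
  then show "lam *\<^sub>R mgradL a x y + x - fst z0 = 0"
    using lam unfolding z0 fst_conv add_diff_eq[symmetric]
    by (simp only: scaleR_add_right[of lam "mgradL a x y"]) simp
qed

text \<open>On the orthant a variational inequality is a complementarity condition:
  \<open>y + axis i 1\<close> tests the signs, while 0 and \<open>2 *\<^sub>R y\<close> force
  orthogonality.\<close>

lemma nonneg_of_inner_nonneg:
  fixes c y :: "real^'m"
  assumes "0 \<le> y" and "\<And>y'. 0 \<le> y' \<Longrightarrow> 0 \<le> (y' - y) \<bullet> c"
  shows "0 \<le> c" "y \<bullet> c = 0"
proof -
  have "0 \<le> c $ i" for i
  proof -
    have "0 \<le> y + axis i 1" using assms(1) by (auto simp: less_eq_vec_def axis_def)
    from assms(2)[OF this] show ?thesis by (simp add: inner_axis')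
  qed
  then show "0 \<le> c" by (simp add: less_eq_vec_def)
  show "y \<bullet> c = 0"
    using assms(2)[of 0] assms(2)[of "2 *\<^sub>R y"] assms(1)
    by (force simp: less_eq_vec_def inner_diff_left)
qed

lemma model_error:
  assumes "0 \<le> y"
  shows "norm (gradL x y - mgradL a x y) \<le> B y * (norm (x - a))\<^sup>2"
    and "norm (g x - taylor2_vec g a x) \<le> norm Lg / 6 * (norm (x - a))^3"
proof -
  let ?r = "norm (x - a)"
  have "gradL x y - mgradL a x y = (grad f x - mgrad_f a x)
      + (\<Sum>i\<in>UNIV. y $ i *\<^sub>R (grad (\<lambda>u. g u $ i) x - mgrad_g a i x))"
    by (simp add: gradmat_mult scaleR_diff_right sum_subtractf algebra_simps)
  also have "norm \<dots> \<le> L0 / 2 * ?r\<^sup>2 + (\<Sum>i\<in>UNIV. y $ i * (Lg $ i / 2 * ?r\<^sup>2))"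
  proof (rule norm_triangle_mono)
    show "norm (grad f x - mgrad_f a x) \<le> L0 / 2 * ?r\<^sup>2"
      using f.grad_taylor[of a "x - a"] by (simp add: algebra_simps)
    show "norm (\<Sum>i\<in>UNIV. y $ i *\<^sub>R (grad (\<lambda>u. g u $ i) x - mgrad_g a i x))
        \<le> (\<Sum>i\<in>UNIV. y $ i * (Lg $ i / 2 * ?r\<^sup>2))"
    proof (rule sum_norm_le)
      fix i
      have "0 \<le> y $ i" using assms by (simp add: less_eq_vec_def)
      then show "norm (y $ i *\<^sub>R (grad (\<lambda>u. g u $ i) x - mgrad_g a i x)) \<le> y $ i * (Lg $ i / 2 * ?r\<^sup>2)"
        using mult_left_mono[OF g.grad_taylor[where i = i and x = a and d = "x - a"], of "y $ i"] by (simp add: diff_diff_eq)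
    qed
  qed
  also have "\<dots> = B y * ?r\<^sup>2"
    by (simp add: abs_vec_nonneg[OF assms] inner_vec_def sum_distrib_left
        sum_divide_distrib add_divide_distrib distrib_left mult_ac)
  finally show "norm (gradL x y - mgradL a x y) \<le> B y * ?r\<^sup>2" .
  have "norm (g x - taylor2_vec g a x) \<le> norm ((?r^3 / 6) *\<^sub>R Lg)"
  proof (rule norm_le_componentwise_cart)
    fix i
    show "norm ((g x - taylor2_vec g a x) $ i) \<le> norm (((?r^3 / 6) *\<^sub>R Lg) $ i)"
      using g.taylor2_error[where i = i and x = a and d = "x - a"] g.L_nonneg[of i]
      by (simp add: taylor2_vec_def abs_mult mult_ac)
  qed
  then show "norm (g x - taylor2_vec g a x) \<le> norm Lg / 6 * ?r^3"
    by (simp add: mult_ac)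
qed

text \<open>The model saddle operator plus the proximal term is strongly monotone and \<open>a\<close> solves its inclusion
  with residual \<open>\<rho>\<close>, so \<open>\<parallel>zh - a\<parallel> \<le> \<rho>\<close>; the Taylor errors then make the new residual at most \<open>\<theta>\<rho>\<close>.\<close>

lemma newton_step:
  assumes lam: "0 < lam" and \<theta>: "0 < \<theta>" "\<theta> \<le> 1 / 4"
    and a: "a \<in> nbhd f g L0 Lg \<theta> z0 lam"
    and sol: "minmax_solution (reg_lagrangian f g (fst a) z0 lam) {0..} zh"
  shows "zh \<in> nbhd f g L0 Lg (\<theta>\<^sup>2) z0 lam"
proof -
  obtain xt yt where at: "a = (xt, yt)" by (cases a)
  obtain x y where zh: "zh = (x, y)" by (cases zh)
  obtain x0 y0 where z0: "z0 = (x0, y0)" by (cases z0)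
  let ?T = "taylor2_vec g xt"
  have yt: "0 \<le> yt" using a by (simp add: nbhd_def at)
  note o = minmax_optimality[OF lam sol[unfolded at fst_conv zh]]
  have y: "0 \<le> y" by (rule o(1))
  \<comment> \<open>The complementary slack of the subproblem, read off from its optimality in
    \<open>y\<close>; with it the proximal inclusion of the model holds exactly.\<close>
  define wh where "wh = (1 / lam) *\<^sub>R (y - y0) - ?T x"
  have wh: "0 \<le> wh" "y \<bullet> wh = 0"
    using nonneg_of_inner_nonneg[OF o(1,3)] by (auto simp: wh_def z0)
  define vh where "vh = (mgradL xt x y, - ?T x - wh)"
  have vh: "lam *\<^sub>R vh + zh - z0 = 0"
    using o(2) lam by (simp add: vh_def wh_def zh z0 prod_eq_iff algebra_simps)
  define w where "w = neg_part (g xt + inverse lam *\<^sub>R y0)"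
  have w: "0 \<le> w" by (simp add: w_def neg_part_nonneg)
  define v where "v = opS f g a - (0, w)"
  define \<rho> where "\<rho> = sqrt (Psi f g z0 lam a)"
  have Psi0: "0 \<le> Psi f g z0 lam a" using lam yt by (intro Psi_nonneg) (auto simp: at)
  have \<rho>: "0 \<le> \<rho>" "\<rho>\<^sup>2 = (norm (lam *\<^sub>R v + a - z0))\<^sup>2 + 2 * lam * (yt \<bullet> w)"
    using Psi0 Psi_eq[OF lam, of a z0] yt by (auto simp: \<rho>_def at v_def w_def z0)
  have "(norm (zh - a))\<^sup>2 \<le> \<rho>\<^sup>2"
  proof -
    \<comment> \<open>At \<open>xt\<close> the model agrees with the problem to first order, so
      \<open>v\<close> belongs to the model operator up to the enlargement
      \<open>yt \<bullet> w\<close>. The loss in monotonicity is what the extra term of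
      \<open>Psi\<close> pays for.\<close>
    have mono: "- (yt \<bullet> w) \<le> (v - vh) \<bullet> (a - zh)"
    proof -
      have T: "?T xt = g xt" "taylor2 f xt xt = f xt" "mgradL xt xt yt = gradL xt yt"
        by (simp_all add: taylor2_vec_def taylor2_def gradmat_mult)
      have "(v - vh) \<bullet> (a - zh) = (gradL xt yt - mgradL xt x y) \<bullet> (xt - x)
          + (?T x + wh - g xt - w) \<bullet> (yt - y)"
        by (simp add: v_def vh_def at zh opS_def algebra_simps)
      moreover have "gradL xt yt \<bullet> (x - xt) \<le> mL xt x yt - mL xt xt yt"
        using mL_above_tangent[OF yt, of xt xt x] unfolding T by linarith
      moreover have "mgradL xt x y \<bullet> (xt - x) \<le> mL xt xt y - mL xt x y"
        using mL_above_tangent[OF y, of xt x xt] by linarith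
      moreover have "0 \<le> wh \<bullet> yt" "0 \<le> w \<bullet> y" using wh w y yt by (auto intro: inner_nonneg_vec)
      ultimately show ?thesis
        using wh(2) unfolding T by (simp add: inner_diff inner_add inner_commute)
    qed
    define s where "s = v - vh"
    have "lam *\<^sub>R v + a - z0 = lam *\<^sub>R s + (a - zh) + (lam *\<^sub>R vh + zh - z0)"
      by (simp add: s_def algebra_simps)
    then have e: "lam *\<^sub>R v + a - z0 = lam *\<^sub>R s + (a - zh)" using vh by simp
    have "(norm (lam *\<^sub>R s + (a - zh)))\<^sup>2
        = lam\<^sup>2 * (norm s)\<^sup>2 + 2 * lam * (s \<bullet> (a - zh)) + (norm (a - zh))\<^sup>2"
      unfolding power2_norm_eq_inner by (simp add: inner_add inner_commute power2_eq_square)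
    moreover have "lam * - (yt \<bullet> w) \<le> lam * (s \<bullet> (a - zh))"
      using mono lam unfolding s_def by (intro mult_left_mono) auto
    moreover have "0 \<le> lam\<^sup>2 * (norm s)\<^sup>2" by simp
    ultimately have "(norm (a - zh))\<^sup>2 \<le> (norm (lam *\<^sub>R s + (a - zh)))\<^sup>2 + 2 * lam * (yt \<bullet> w)"
      by linarith
    then show ?thesis unfolding \<rho>(2) e by (simp add: norm_minus_commute)
  qed
  then have d: "norm (zh - a) \<le> \<rho>" using \<rho>(1) by (rule power2_le_imp_le)
  then have dx: "norm (x - xt) \<le> \<rho>" and dy: "norm (y - yt) \<le> \<rho>"
    using norm_fst_le[of "x - xt" "y - yt"] norm_snd_le[of "y - yt" "x - xt"] by (simp_all add: zh at)
  define \<rho>' where "\<rho>' = sqrt (Psi f g z0 lam zh)"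
  have \<rho>'0: "0 \<le> \<rho>'" using Psi_nonneg[OF lam, of zh z0] y by (simp add: \<rho>'_def zh)
  have By: "B y \<le> B yt + norm Lg * \<rho> / 2"
    using B_lipschitz[of y yt] mult_left_mono[OF dy, of "norm Lg"] by simp
  \<comment> \<open>\<open>wh\<close> is a feasible choice in \<open>Psi\<close> at
    \<open>zh\<close>: complementarity removes the inner product, and the exact inclusion cancels
    everything but the model errors.\<close>
  have "\<rho>' \<le> lam * quad_bound L0 Lg yt \<rho> * \<rho>"
  proof -
    have "lam *\<^sub>R (opS f g zh - (0, wh)) + zh - z0
        = lam *\<^sub>R (gradL x y - mgradL xt x y, ?T x - g x) + (lam *\<^sub>R vh + zh - z0)"
      by (simp add: opS_def zh vh_def algebra_simps)
    then have "Psi_obj z0 lam zh wh = (norm (lam *\<^sub>R (gradL x y - mgradL xt x y, ?T x - g x)))\<^sup>2"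
      using wh(2) unfolding vh by (simp add: zh)
    then have "\<rho>' \<le> norm (lam *\<^sub>R (gradL x y - mgradL xt x y, ?T x - g x))"
      using Psi_le[of lam zh wh z0] lam y wh(1) unfolding \<rho>'_def
      by (intro real_le_lsqrt) (auto simp: zh)
    also have "\<dots> = lam * norm (gradL x y - mgradL xt x y, ?T x - g x)"
      unfolding norm_scaleR using lam by simp
    also have "\<dots> \<le> lam * (norm (gradL x y - mgradL xt x y) + norm (g x - ?T x))"
      using lam norm_Pair_le[of "gradL x y - mgradL xt x y" "?T x - g x"]
      by (intro mult_left_mono) (auto simp: norm_minus_commute)
    \<comment> \<open>Origin of the constant 2/3 in \<open>quad_bound\<close>: 1/2 from replacing
      \<open>y\<close> by \<open>yt\<close> in \<open>B\<close>, plus 1/6 from the cubic remainder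
      of \<open>g\<close>.\<close>
    also have "\<dots> \<le> lam * ((B yt + norm Lg * \<rho> / 2) * \<rho>\<^sup>2 + norm Lg / 6 * \<rho>^3)"
    proof (intro mult_left_mono add_mono)
      have "B y * (norm (x - xt))\<^sup>2 \<le> (B yt + norm Lg * \<rho> / 2) * \<rho>\<^sup>2"
        using By dx \<rho>(1) B_nonneg[of yt] by (intro mult_mono power_mono) auto
      then show "norm (gradL x y - mgradL xt x y) \<le> (B yt + norm Lg * \<rho> / 2) * \<rho>\<^sup>2"
        using model_error(1)[OF y, of x xt] by linarith
      have "norm Lg / 6 * (norm (x - xt))^3 \<le> norm Lg / 6 * \<rho>^3"
        using dx by (intro mult_left_mono power_mono) auto
      then show "norm (g x - ?T x) \<le> norm Lg / 6 * \<rho>^3"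
        using model_error(2)[OF y, of x xt] by linarith
    qed (use lam in auto)
    also have "\<dots> = lam * quad_bound L0 Lg yt \<rho> * \<rho>"
      by (simp add: quad_bound_def field_simps power2_eq_square power3_eq_cube)
    finally show ?thesis .
  qed
  also have q: "lam * quad_bound L0 Lg yt \<rho> \<le> \<theta>"
    using a by (simp add: nbhd_def at \<rho>_def)
  finally have r: "\<rho>' \<le> \<theta> * \<rho>" using \<rho>(1) by (simp add: mult_right_mono)
  have "quad_bound L0 Lg y \<rho>' \<le> \<theta> * quad_bound L0 Lg yt \<rho>"
  proof -
    \<comment> \<open>Origin of the bound 1/4: 2/3 of \<open>\<rho> / 4\<close> is
      \<open>\<rho> / 6\<close>, just what is left of 2/3 after the change of \<open>B\<close> has
      used 1/2.\<close>
    have "\<theta> * \<rho> \<le> 1 / 4 * \<rho>" using \<theta> \<rho>(1) by (intro mult_right_mono)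
    then have "norm Lg * \<rho>' \<le> norm Lg * (\<rho> / 4)" using r by (intro mult_left_mono) auto
    then have "2 * norm Lg / 3 * \<rho>' \<le> norm Lg * \<rho> / 6" by (simp add: mult_ac)
    moreover have "2 * norm Lg / 3 * \<rho> = norm Lg * \<rho> / 2 + norm Lg * \<rho> / 6" by simp
    ultimately have "B y + 2 * norm Lg / 3 * \<rho>' \<le> B yt + 2 * norm Lg / 3 * \<rho>"
      using By by linarith
    then have "(B y + 2 * norm Lg / 3 * \<rho>') * \<rho>' \<le> (B yt + 2 * norm Lg / 3 * \<rho>) * (\<theta> * \<rho>)"
      using r \<rho>'0 B_nonneg[of yt] \<rho>(1) by (intro mult_mono) auto
    then show ?thesis by (simp add: quad_bound_def mult_ac)
  qed
  then have "lam * quad_bound L0 Lg y \<rho>' \<le> lam * (\<theta> * quad_bound L0 Lg yt \<rho>)"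
    using lam by (intro mult_left_mono) auto
  also have "\<dots> = \<theta> * (lam * quad_bound L0 Lg yt \<rho>)" by simp
  also have "\<dots> \<le> \<theta> * \<theta>" using q \<theta> by (intro mult_left_mono) auto
  finally show ?thesis using y by (simp add: nbhd_def zh \<rho>'_def power2_eq_square)
qed

end

section \<open>Runs of the algorithm\<close>

context convex_problem
begin

text \<open>For \<open>y'\<close> outside the orthant the gap is infinite, so testing
  \<open>0 \<le> y'\<close> is enough.\<close>

lemma gap_in_eps_subdiff:
  assumes "0 \<le> \<epsilon>" "0 \<le> snd z"
    and "\<And>x' y'. 0 \<le> y' \<Longrightarrow> v \<bullet> ((x', y') - z) - \<epsilon> \<le> f x' + snd z \<bullet> g x' - (f (fst z) + y' \<bullet> g (fst z))"
  shows "v \<in> eps_subdiff \<epsilon> (lagrangian_gap f g z) z"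
proof -
  have "lagrangian_gap f g z z + ereal (v \<bullet> (z' - z) - \<epsilon>) \<le> lagrangian_gap f g z z'" for z'
    using assms(2) assms(3)[of "snd z'" "fst z'"]
    by (cases z; cases z') (auto simp: lagrangian_gap_def ext_lagrangian_def)
  then show ?thesis using assms(1) by (simp add: eps_subdiff_def)
qed

text \<open>With \<open>x'\<close> fixed at the base point, an affine function of \<open>y'\<close>
  is bounded above on the orthant, which forces the sign of \<open>g (fst z) + snd v\<close>; its
  value at 0 gives the lower bound. With \<open>y' = 0\<close> the inequality in \<open>x'\<close>
  remains, and the leftover terms form the new error.\<close>

lemma gap_splitting:
  assumes "0 \<le> snd z"
    and gap: "\<And>x' y'. 0 \<le> y' \<Longrightarrow> v \<bullet> ((x', y') - z) - \<epsilon> \<le> f x' + snd z \<bullet> g x' - (f (fst z) + y' \<bullet> g (fst z))"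
  shows "fst v \<in> eps_subdiff (\<epsilon> + snd z \<bullet> (g (fst z) + snd v)) (\<lambda>x. ext_lagrangian f g x (snd z)) (fst z)"
    and "g (fst z) + snd v \<le> 0"
    and "- \<epsilon> \<le> snd z \<bullet> (g (fst z) + snd v)"
proof -
  obtain x y where z: "z = (x, y)" by (cases z)
  obtain p q where v: "v = (p, q)" by (cases v)
  have y: "0 \<le> y" using assms(1) by (simp add: z)
  have *: "p \<bullet> (x' - x) + q \<bullet> (y' - y) - \<epsilon> \<le> f x' + y \<bullet> g x' - (f x + y' \<bullet> g x)" if "0 \<le> y'" for x' y'
    using gap[OF that, of x'] by (simp add: z v)
  have **: "(y' - y) \<bullet> (g x + q) \<le> \<epsilon>" if "0 \<le> y'" for y'
    using *[OF that, of x] by (simp add: inner_diff inner_add inner_commute)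
  show low: "- \<epsilon> \<le> snd z \<bullet> (g (fst z) + snd v)"
    using **[of 0] by (simp add: z v)
  have "(g x + q) $ i \<le> 0" for i
  proof (rule ccontr)
    assume "\<not> (g x + q) $ i \<le> 0"
    then have pos: "0 < (g x + q) $ i" by simp
    \<comment> \<open>Makes \<open>t * (g x + q) $ i\<close> equal to
      \<open>\<bar>\<epsilon>\<bar> + 1\<close>, beyond the admissible
      \<open>\<epsilon>\<close>.\<close>
    define t where "t = (\<bar>\<epsilon>\<bar> + 1) / (g x + q) $ i"
    have "0 \<le> t" using pos by (simp add: t_def)
    then have "0 \<le> y + t *\<^sub>R axis i 1" using y by (auto simp: less_eq_vec_def axis_def)
    from **[OF this] have "t * (g x + q) $ i \<le> \<epsilon>" by (simp add: inner_axis')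
    then show False using pos by (simp add: t_def)
  qed
  then show "g (fst z) + snd v \<le> 0" by (simp add: z v less_eq_vec_def)
  have "f x + y \<bullet> g x + (p \<bullet> (x' - x) - (\<epsilon> + y \<bullet> (g x + q))) \<le> f x' + y \<bullet> g x'" for x'
    using *[of 0 x'] by (simp add: inner_add_right inner_commute)
  then show "fst v \<in> eps_subdiff (\<epsilon> + snd z \<bullet> (g (fst z) + snd v)) (\<lambda>x. ext_lagrangian f g x (snd z)) (fst z)"
    using low y by (simp add: z v eps_subdiff_def ext_lagrangian_def)
qed

end

locale algorithm_run = convex_problem f g L0 Lg
  for f :: "real^'n \<Rightarrow> real" and g :: "real^'n \<Rightarrow> real^'m" and L0 :: real and Lg :: "real^'m" +
  fixes \<sigma> \<theta> :: real and z zt :: "nat \<Rightarrow> (real^'n) \<times> (real^'m)" and lam :: "nat \<Rightarrow> real"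
  assumes run: "algorithm1 f g L0 Lg \<sigma> \<theta> z zt lam"
begin

abbreviation \<tau> where "\<tau> \<equiv> tau \<sigma> \<theta>"
abbreviation h where "h \<equiv> h_root \<sigma> \<theta>"
abbreviation large where "large \<equiv> large_step L0 Lg \<sigma> \<theta> z zt lam"
text \<open>By \<open>Psi_eq\<close> this is the minimiser in
  \<open>Psi f g (z (k - 1)) (lam k) (zt k)\<close>, so that \<open>Psi\<close> is the left-hand
  side of the HPE criterion for \<open>v\<close> and \<open>\<epsilon>\<close> below.\<close>

definition w where "w k = neg_part (g (fst (zt k)) + inverse (lam k) *\<^sub>R snd (z (k - 1)))"
definition v where "v k = opS f g (zt k) - (0, w k)"
definition \<epsilon> where "\<epsilon> k = snd (zt k) \<bullet> w k"

lemma \<sigma>: "0 < \<sigma>" "\<sigma> < 1" and \<theta>: "0 < \<theta>" "\<theta> \<le> 1 / 4"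
  using run by (auto simp: algorithm1_def)

lemma h: "0 < h" "\<theta> * (1 + h) * (1 + h * (1 + 1 / \<sigma>))\<^sup>2 = 1"
  using h_root_properties[of \<sigma> \<theta>] \<sigma> \<theta> by auto

lemma \<tau>: "0 < \<tau>" "\<tau> < 1" "inverse (1 - \<tau>) = 1 + h"
  using h(1) by (auto simp: tau_def field_simps)

lemma run_large:
  assumes "1 \<le> k" "large k"
  shows "lam (k + 1) = (1 - \<tau>) * lam k" "zt (k + 1) = zt k"
    and "z k = (fst (z (k - 1)) - (\<tau> * lam k) *\<^sub>R gradL (fst (zt k)) (snd (zt k)),
      snd (z (k - 1)) + \<tau> *\<^sub>R (lam k *\<^sub>R g (fst (zt k))
        + neg_part (lam k *\<^sub>R g (fst (zt k)) + snd (z (k - 1)))))"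
  using run assms by (auto simp: algorithm1_def Let_def)

lemma run_small:
  assumes "1 \<le> k" "\<not> large k"
  shows "lam (k + 1) = (1 + h) * lam k" "z k = z (k - 1)"
    and "minmax_solution (reg_lagrangian f g (fst (zt k)) (z k) (lam (k + 1))) {0..} (zt (k + 1))"
proof -
  have "lam (k + 1) = inverse (1 - \<tau>) * lam k \<and> z k = z (k - 1) \<and>
      minmax_solution (reg_lagrangian f g (fst (zt k)) (z k) (lam (k + 1))) {0..} (zt (k + 1))"
    using run assms unfolding algorithm1_def Let_def
    by (elim conjE allE[of _ k] impE) (assumption, erule (1) if_not_P[THEN iffD1])
  then show "lam (k + 1) = (1 + h) * lam k" "z k = z (k - 1)"
    "minmax_solution (reg_lagrangian f g (fst (zt k)) (z k) (lam (k + 1))) {0..} (zt (k + 1))"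
    unfolding \<tau>(3) by blast+
qed

text \<open>Positive homogeneity of \<open>neg_part\<close> identifies the correction in the
  multiplier update with \<open>lam k *\<^sub>R w k\<close>; both components then form one step
  along \<open>v k\<close>.\<close>

lemma z_large:
  assumes "1 \<le> k" "large k" "0 < lam k"
  shows "z k = z (k - 1) - (\<tau> * lam k) *\<^sub>R v k"
proof -
  have "neg_part (lam k *\<^sub>R g (fst (zt k)) + snd (z (k - 1))) = lam k *\<^sub>R w k"
    using assms(3) by (auto simp: w_def neg_part_def vec_eq_iff max_def field_simps)
  then show ?thesis
    unfolding run_large(3)[OF assms(1,2)]
    by (cases "z (k - 1)"; cases "zt k") (simp add: v_def opS_def algebra_simps)
qed

lemma w_nonneg: "0 \<le> w k"
  by (simp add: w_def neg_part_nonneg)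

lemma invariant: "0 < lam k \<and> zt k \<in> nbhd f g L0 Lg (\<theta>\<^sup>2) (z (k - 1)) (lam k)" if "1 \<le> k"
  using that
proof (induction k rule: dec_induct)
  case base
  show ?case using run by (auto simp: algorithm1_def)
next
  case (step k)
  have k: "1 \<le> k" and lam: "0 < lam k" using step by auto
  obtain xt yt where zt: "zt k = (xt, yt)" by (cases "zt k")
  define r where "r = sqrt (Psi f g (z (k - 1)) (lam k) (zt k))"
  have yt: "0 \<le> yt" and nb: "lam k * quad_bound L0 Lg yt r \<le> \<theta>\<^sup>2"
    using step.IH by (auto simp: nbhd_def zt r_def)
  have r0: "0 \<le> r" using Psi_nonneg[OF lam, of "zt k"] yt by (simp add: r_def zt)
  define e where "e = lam k *\<^sub>R v k + zt k - z (k - 1)"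
  have Psi: "r\<^sup>2 = (norm e)\<^sup>2 + 2 * lam k * \<epsilon> k"
    using Psi_eq[OF lam, of "zt k" "z (k - 1)"] Psi_nonneg[OF lam, of "zt k" "z (k - 1)"] yt
    by (simp add: r_def zt v_def w_def \<epsilon>_def e_def)
  have \<epsilon>0: "0 \<le> \<epsilon> k" unfolding \<epsilon>_def using yt w_nonneg by (intro inner_nonneg_vec) (auto simp: zt)
  show ?case
  proof (cases "large k")
    case True
    note R = run_large[OF k True]
    have lam': "0 < lam (k + 1)" "lam (k + 1) \<le> lam k" using R(1) lam \<tau> by (auto simp: mult_le_cancel_right1)
    define r' where "r' = sqrt (Psi f g (z k) (lam (k + 1)) (zt k))"
    \<comment> \<open>\<open>z\<close> moves by exactly the part of
      \<open>lam k *\<^sub>R v k\<close> that the smaller \<open>lam (k + 1)\<close> gives up, so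
      the residual vector is unchanged.\<close>
    have "lam (k + 1) *\<^sub>R v k + zt k - z k = e"
      unfolding z_large[OF k True lam] R(1) e_def by (simp add: algebra_simps)
    then have "Psi f g (z k) (lam (k + 1)) (zt k) \<le> (norm e)\<^sup>2 + 2 * lam (k + 1) * \<epsilon> k"
      using Psi_le[of "lam (k + 1)" "zt k" "w k" "z k"] lam' yt w_nonneg
      by (simp add: zt v_def[symmetric] \<epsilon>_def v_def)
    also have "\<dots> \<le> r\<^sup>2" unfolding Psi using lam' \<epsilon>0 by (simp add: mult_right_mono)
    finally have "r' \<le> r" unfolding r'_def using r0 by (rule real_le_lsqrt[rotated 1])
    moreover have "0 \<le> r'" using Psi_nonneg[OF lam'(1), of "zt k"] yt by (simp add: r'_def zt)
    ultimately have "quad_bound L0 Lg yt r' \<le> quad_bound L0 Lg yt r" by (intro quad_bound_mono)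
    then have "lam (k + 1) * quad_bound L0 Lg yt r' \<le> lam k * quad_bound L0 Lg yt r"
      using lam' lam quad_bound_nonneg[OF r0, of yt] quad_bound_nonneg[OF \<open>0 \<le> r'\<close>, of yt] by (intro mult_mono) auto
    then show ?thesis
      using nb lam' yt R(2) by (simp add: nbhd_def zt r'_def)
  next
    case False
    note R = run_small[OF k False]
    have lam': "0 < lam (k + 1)" using R(1) lam h by simp
    define P where "P = rho L0 Lg yt (\<theta>\<^sup>2 / lam k)"
    have \<alpha>: "0 < \<theta>\<^sup>2 / lam k" using \<theta> lam by simp
    have P: "0 < P" "quad_bound L0 Lg yt P = \<theta>\<^sup>2 / lam k" using rho_root[OF \<alpha>] by (auto simp: P_def)
    define D where "D = norm (zt k - z (k - 1))"
    have "\<sigma> * D < P" using False by (simp add: large_step_def P_def D_def zt not_le)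
    then have D: "D < P / \<sigma>" using \<sigma> by (simp add: field_simps)
    have rP: "r \<le> P"
      unfolding P_def using nb lam by (intro le_rho[OF \<alpha>]) (simp add: pos_le_divide_eq mult.commute)
    define r' where "r' = sqrt (Psi f g (z k) (lam (k + 1)) (zt k))"
    \<comment> \<open>The surplus \<open>(h * lam k) *\<^sub>R v k\<close> is expressed through
      \<open>e\<close> at the price of a multiple of the step \<open>zt k - z (k - 1)\<close>, which
      is shorter than \<open>P / \<sigma>\<close> because the large-step test failed.\<close>
    have e': "lam (k + 1) *\<^sub>R v k + zt k - z k = (1 + h) *\<^sub>R e - h *\<^sub>R (zt k - z (k - 1))"
      unfolding R(1,2) e_def by (simp add: algebra_simps)
    have "Psi f g (z k) (lam (k + 1)) (zt k) \<le> (norm ((1 + h) *\<^sub>R e - h *\<^sub>R (zt k - z (k - 1))))\<^sup>2 + 2 * lam (k + 1) * \<epsilon> k"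
      using Psi_le[of "lam (k + 1)" "zt k" "w k" "z k"] lam' yt w_nonneg
      unfolding e'[symmetric] by (simp add: zt v_def[symmetric] \<epsilon>_def v_def)
    \<comment> \<open>The factor of the \<open>\<epsilon>\<close> term is raised from
      \<open>1 + h\<close> to its square so that it recombines with \<open>(norm e)\<^sup>2\<close>
      into \<open>r\<^sup>2\<close>.\<close>
    also have "\<dots> \<le> ((1 + h) * norm e + h * D)\<^sup>2 + (1 + h)\<^sup>2 * (2 * lam k * \<epsilon> k)"
    proof (intro add_mono power_mono)
      show "norm ((1 + h) *\<^sub>R e - h *\<^sub>R (zt k - z (k - 1))) \<le> (1 + h) * norm e + h * D"
        using norm_triangle_ineq4[of "(1 + h) *\<^sub>R e" "h *\<^sub>R (zt k - z (k - 1))"] h by (simp add: D_def)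
      have "(1 + h) * (2 * lam k * \<epsilon> k) \<le> (1 + h)\<^sup>2 * (2 * lam k * \<epsilon> k)"
        using h \<epsilon>0 lam by (intro mult_right_mono) (auto simp: power2_eq_square)
      then show "2 * lam (k + 1) * \<epsilon> k \<le> (1 + h)\<^sup>2 * (2 * lam k * \<epsilon> k)"
        unfolding R(1) by (simp only: mult_ac)
    qed auto
    also have "\<dots> = (1 + h)\<^sup>2 * r\<^sup>2 + 2 * (1 + h) * h * D * norm e + (h * D)\<^sup>2"
      unfolding Psi by (simp add: algebra_simps power2_eq_square)
    also have "\<dots> \<le> (1 + h)\<^sup>2 * r\<^sup>2 + 2 * (1 + h) * h * D * r + (h * D)\<^sup>2"
    proof -
      have "(norm e)\<^sup>2 \<le> r\<^sup>2" unfolding Psi using \<epsilon>0 lam by simp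
      then have "norm e \<le> r" using r0 by (rule power2_le_imp_le)
      then have "2 * (1 + h) * h * D * norm e \<le> 2 * (1 + h) * h * D * r"
        using h by (intro mult_left_mono) (auto simp: D_def)
      then show ?thesis by simp
    qed
    also have "\<dots> = ((1 + h) * r + h * D)\<^sup>2" by (simp add: algebra_simps power2_eq_square)
    finally have "r' \<le> (1 + h) * r + h * D"
      unfolding r'_def using h r0 by (intro real_le_lsqrt) (auto simp: D_def)
    also have "\<dots> \<le> (1 + h) * P + h * (P / \<sigma>)"
      using h rP D by (intro add_mono mult_left_mono) auto
    also have "\<dots> = (1 + h * (1 + 1 / \<sigma>)) * P" by (simp add: algebra_simps)
    finally have r': "r' \<le> (1 + h * (1 + 1 / \<sigma>)) * P" .
    have "0 \<le> r'" using Psi_nonneg[OF lam', of "zt k"] yt by (simp add: r'_def zt)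
    then have "quad_bound L0 Lg yt r' \<le> quad_bound L0 Lg yt ((1 + h * (1 + 1 / \<sigma>)) * P)"
      using r' by (rule quad_bound_mono)
    also have "\<dots> \<le> (1 + h * (1 + 1 / \<sigma>))\<^sup>2 * quad_bound L0 Lg yt P"
      using h \<sigma> P by (intro quad_bound_scale) auto
    finally have "lam (k + 1) * quad_bound L0 Lg yt r'
        \<le> lam (k + 1) * ((1 + h * (1 + 1 / \<sigma>))\<^sup>2 * quad_bound L0 Lg yt P)"
      using lam' by (intro mult_left_mono) auto
    \<comment> \<open>The growth of \<open>lam\<close> and that of \<open>quad_bound\<close> meet
      one of the two factors \<open>\<theta>\<close>; the equation of \<open>h_root\<close> makes
      this product 1.\<close>
    also have "\<dots> = \<theta> * (\<theta> * (1 + h) * (1 + h * (1 + 1 / \<sigma>))\<^sup>2)"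
      unfolding P(2) R(1) using lam by (simp add: power2_eq_square mult_ac)
    also have "\<dots> = \<theta>" unfolding h(2) by simp
    finally have "zt k \<in> nbhd f g L0 Lg \<theta> (z k) (lam (k + 1))"
      using yt by (simp add: nbhd_def zt r'_def)
    from newton_step[OF lam' \<theta> this R(3)] show ?thesis using lam' by simp
  qed
qed

lemma lam_pos: "1 \<le> k \<Longrightarrow> 0 < lam k"
  and yt_nonneg: "1 \<le> k \<Longrightarrow> 0 \<le> snd (zt k)"
  using invariant[of k] by (auto simp: nbhd_def)

lemma \<epsilon>_nonneg: "1 \<le> k \<Longrightarrow> 0 \<le> \<epsilon> k"
  unfolding \<epsilon>_def by (intro inner_nonneg_vec yt_nonneg w_nonneg)

text \<open>The invariant puts the residual below \<open>rho\<close>, the large-step test puts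
  \<open>rho\<close> below \<open>\<sigma>\<close> times the step length, and \<open>w k\<close>
  realises the minimum in \<open>Psi\<close>.\<close>

lemma hpe_error:
  assumes k: "1 \<le> k" "large k"
  shows "(norm (lam k *\<^sub>R v k + zt k - z (k - 1)))\<^sup>2 + 2 * lam k * \<epsilon> k
    \<le> \<sigma>\<^sup>2 * (norm (zt k - z (k - 1)))\<^sup>2"
proof -
  define r where "r = sqrt (Psi f g (z (k - 1)) (lam k) (zt k))"
  have lam: "0 < lam k" by (rule lam_pos[OF k(1)])
  have Psi0: "0 \<le> Psi f g (z (k - 1)) (lam k) (zt k)" by (rule Psi_nonneg[OF lam yt_nonneg[OF k(1)]])
  have "lam k * quad_bound L0 Lg (snd (zt k)) r \<le> \<theta>\<^sup>2"
    using invariant[OF k(1)] by (auto simp: nbhd_def r_def)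
  then have "r \<le> rho L0 Lg (snd (zt k)) (\<theta>\<^sup>2 / lam k)"
    using lam \<theta> by (intro le_rho) (simp_all add: pos_le_divide_eq mult.commute)
  also have "\<dots> \<le> \<sigma> * norm (zt k - z (k - 1))" using k(2) by (simp add: large_step_def)
  finally have "r\<^sup>2 \<le> (\<sigma> * norm (zt k - z (k - 1)))\<^sup>2"
    using Psi0 by (intro power_mono) (auto simp: r_def)
  then show ?thesis
    using Psi0 Psi_eq[OF lam yt_nonneg[OF k(1)], of "z (k - 1)"]
    by (simp add: r_def power_mult_distrib v_def w_def \<epsilon>_def)
qed

text \<open>Origin of \<open>c\<close>: evaluating \<open>quad_bound\<close> at
  \<open>\<sigma>\<close> times the step length leaves a factor that depends on \<open>k\<close>.
  The multipliers drift by at most \<open>d0 + d0 / s\<close>, which \<open>B_lipschitz\<close>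
  weights with 1/2, and the step is at most \<open>d0 / s\<close>, which contributes
  \<open>2 * \<sigma> / 3\<close>.\<close>

lemma large_step_lower_bound:
  assumes k: "1 \<le> k" "large k"
    and d0: "norm (z 0 - zs) \<le> d0"
    and zt: "norm (zt k - zs) \<le> d0 / sqrt (1 - \<sigma>\<^sup>2)"
    and D: "norm (zt k - z (k - 1)) \<le> d0 / sqrt (1 - \<sigma>\<^sup>2)"
  shows "\<theta>\<^sup>2 \<le> lam k * (\<sigma> * norm (zt k - z (k - 1))) *
    ((L0 + Lg \<bullet> \<bar>snd (z 0)\<bar>) / 2 + (1 / 2 + (1 / 2 + 2 * \<sigma> / 3) / sqrt (1 - \<sigma>\<^sup>2)) * d0 * norm Lg)"
proof -
  define D where "D = norm (zt k - z (k - 1))"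
  define s where "s = sqrt (1 - \<sigma>\<^sup>2)"
  let ?y = "snd (zt k)" and ?b = "snd (z 0)"
  have lam: "0 < lam k" by (rule lam_pos[OF k(1)])
  then have \<alpha>: "0 < \<theta>\<^sup>2 / lam k" using \<theta> by simp
  have "\<theta>\<^sup>2 / lam k = quad_bound L0 Lg ?y (rho L0 Lg ?y (\<theta>\<^sup>2 / lam k))"
    using rho_root(2)[OF \<alpha>] by simp
  also have "\<dots> \<le> quad_bound L0 Lg ?y (\<sigma> * D)"
    using k(2) rho_root(1)[OF \<alpha>, of ?y] by (intro quad_bound_mono) (auto simp: large_step_def D_def)
  finally have "\<theta>\<^sup>2 \<le> lam k * quad_bound L0 Lg ?y (\<sigma> * D)"
    using lam by (simp add: pos_divide_le_eq mult.commute)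
  also have "\<dots> = lam k * (\<sigma> * D) * (B ?y + 2 * norm Lg / 3 * (\<sigma> * D))"
    by (simp add: quad_bound_def)
  also have "\<dots> \<le> lam k * (\<sigma> * D) *
      ((L0 + Lg \<bullet> \<bar>?b\<bar>) / 2 + (1 / 2 + (1 / 2 + 2 * \<sigma> / 3) / s) * d0 * norm Lg)"
  proof (rule mult_left_mono)
    have "norm (?y - ?b) \<le> norm (zt k - z 0)"
      by (metis norm_snd_le prod.collapse snd_diff)
    also have "\<dots> \<le> d0 / s + d0"
      using norm_triangle_ineq4[of "zt k - zs" "z 0 - zs"] zt d0 by (simp add: s_def)
    finally have "norm Lg * norm (?y - ?b) \<le> norm Lg * (d0 / s + d0)" by (intro mult_left_mono) auto
    then have "norm Lg * norm (?y - ?b) / 2 \<le> norm Lg * (d0 / s + d0) / 2"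
      by (rule divide_right_mono) simp
    then have "B ?y \<le> B ?b + norm Lg * (d0 / s + d0) / 2"
      by (rule order_trans[OF B_lipschitz add_left_mono])
    moreover have "2 * norm Lg / 3 * (\<sigma> * D) \<le> 2 * norm Lg / 3 * (\<sigma> * (d0 / s))"
      using D \<sigma> by (intro mult_left_mono) (auto simp: D_def s_def)
    ultimately have "B ?y + 2 * norm Lg / 3 * (\<sigma> * D)
        \<le> B ?b + norm Lg * (d0 / s + d0) / 2 + 2 * norm Lg / 3 * (\<sigma> * (d0 / s))"
      by linarith
    also have "\<dots> = B ?b + (1 / 2 + (1 / 2 + 2 * \<sigma> / 3) / s) * d0 * norm Lg"
      by (simp add: algebra_simps add_divide_distrib)
    finally show "B ?y + 2 * norm Lg / 3 * (\<sigma> * D)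
        \<le> (L0 + Lg \<bullet> \<bar>?b\<bar>) / 2 + (1 / 2 + (1 / 2 + 2 * \<sigma> / 3) / s) * d0 * norm Lg" .
  qed (use lam \<sigma> in \<open>simp add: D_def\<close>)
  finally show ?thesis by (simp add: D_def s_def)
qed

end

section \<open>Complexity bounds\<close>

text \<open>Finite and infinite \<open>A\<close> are treated together, below the cardinality if
  there is one. The last two facts exclude large steps before the first enumerated index and between
  consecutive ones.\<close>

lemma enumerate_valid:
  fixes A :: "nat set"
  assumes "finite A \<longrightarrow> n < card A"
  shows "enumerate A n \<in> A"
    and "n = Suc m \<Longrightarrow> enumerate A m < enumerate A n"
    and "n = Suc m \<Longrightarrow> enumerate A m < l \<Longrightarrow> l < enumerate A n \<Longrightarrow> l \<notin> A"
    and "n = 0 \<Longrightarrow> l < enumerate A n \<Longrightarrow> l \<notin> A"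
proof -
  show "enumerate A n \<in> A"
    using assms by (cases "finite A") (auto intro: enumerate_in_set finite_enumerate_in_set)
  show "n = Suc m \<Longrightarrow> enumerate A m < enumerate A n"
    using assms by (cases "finite A") (auto intro: enumerate_step finite_enumerate_step)
  show "l \<notin> A" if "n = Suc m" "enumerate A m < l" "l < enumerate A n"
  proof -
    have "enumerate A n = (LEAST s. s \<in> A \<and> enumerate A m < s)"
      using assms that(1) enumerate_Suc''[of A m] finite_enumerate_Suc''[of A m] by (cases "finite A") auto
    then show ?thesis using that not_less_Least[of l "\<lambda>s. s \<in> A \<and> enumerate A m < s"] by auto
  qed
  show "l \<notin> A" if "n = 0" "l < enumerate A n"
    using that not_less_Least[of l "\<lambda>s. s \<in> A"] by (auto simp: enumerate_0)
qed

lemma constant_of_steps: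
  fixes z :: "nat \<Rightarrow> 'a"
  assumes "a \<le> b" and "\<And>k. a < k \<Longrightarrow> k \<le> b \<Longrightarrow> z k = z (k - 1)"
  shows "z b = z a"
  using assms by (induction b rule: dec_induct) (force+)

lemma sum_weighted_diff:
  fixes x :: "nat \<Rightarrow> 'a::real_inner"
  assumes "sum \<alpha> S = (1::real)"
  shows "(\<Sum>j\<in>S. \<alpha> j * (c \<bullet> (x j - (\<Sum>j\<in>S. \<alpha> j *\<^sub>R x j)))) = 0"
proof -
  have "(\<Sum>j\<in>S. \<alpha> j * (c \<bullet> (x j - m))) = c \<bullet> (\<Sum>j\<in>S. \<alpha> j *\<^sub>R x j) - sum \<alpha> S * (c \<bullet> m)" for m
    by (simp add: inner_diff_right right_diff_distrib sum_subtractf inner_sum_right sum_distrib_right)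
  then show ?thesis by (simp add: assms)
qed

context convex_problem
begin

text \<open>The transportation formula for the enlargement of the saddle operator.\<close>

lemma ergodic_gap:
  fixes z v :: "nat \<Rightarrow> (real^'n) \<times> (real^'m)" and \<epsilon> \<alpha> :: "nat \<Rightarrow> real"
  assumes gap: "\<And>j x' y'. j \<in> S \<Longrightarrow> 0 \<le> y' \<Longrightarrow> v j \<bullet> ((x', y') - z j) - \<epsilon> j
      \<le> f x' + snd (z j) \<bullet> g x' - (f (fst (z j)) + y' \<bullet> g (fst (z j)))"
    and \<alpha>: "\<And>j. j \<in> S \<Longrightarrow> 0 \<le> \<alpha> j" "sum \<alpha> S = 1"
    and za: "za = (\<Sum>j\<in>S. \<alpha> j *\<^sub>R z j)" and va: "va = (\<Sum>j\<in>S. \<alpha> j *\<^sub>R v j)"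
    and \<epsilon>a: "\<epsilon>a = (\<Sum>j\<in>S. \<alpha> j * (\<epsilon> j + v j \<bullet> (z j - za)))"
    and y': "0 \<le> y'"
  shows "va \<bullet> ((x', y') - za) - \<epsilon>a \<le> f x' + snd za \<bullet> g x' - (f (fst za) + y' \<bullet> g (fst za))"
proof -
  have fst_za: "fst za = (\<Sum>j\<in>S. \<alpha> j *\<^sub>R fst (z j))" and snd_za: "snd za = (\<Sum>j\<in>S. \<alpha> j *\<^sub>R snd (z j))"
    by (simp_all add: za fst_sum snd_sum)
  have "va \<bullet> ((x', y') - za) - \<epsilon>a = (\<Sum>j\<in>S. \<alpha> j * (v j \<bullet> ((x', y') - z j) - \<epsilon> j))"
    unfolding va \<epsilon>a inner_sum_left sum_subtractf[symmetric]
    by (intro sum.cong) (simp_all only: inner_diff_right inner_scaleR_left, simp_all add: algebra_simps)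
  also have "\<dots> \<le> (\<Sum>j\<in>S. \<alpha> j * (f x' + snd (z j) \<bullet> g x' - (f (fst (z j)) + y' \<bullet> g (fst (z j)))))"
    using gap[OF _ y'] \<alpha> by (intro sum_mono mult_left_mono) auto
  \<comment> \<open>Jensen's inequality for the Lagrangian in \<open>x\<close>, via its tangent at
    \<open>fst za\<close>; the linear terms cancel in the weighted sum.\<close>
  also have "\<dots> \<le> (\<Sum>j\<in>S. \<alpha> j * (f x' + snd (z j) \<bullet> g x'
      - (f (fst za) + y' \<bullet> g (fst za) + gradL (fst za) y' \<bullet> (fst (z j) - fst za))))"
    using lagrangian_above_tangent[OF y', of "fst za"] \<alpha>
    by (intro sum_mono mult_left_mono diff_left_mono) auto
  also have "\<dots> = (\<Sum>j\<in>S. \<alpha> j * f x' + \<alpha> j * (snd (z j) \<bullet> g x') - \<alpha> j * (f (fst za) + y' \<bullet> g (fst za))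
      - \<alpha> j * (gradL (fst za) y' \<bullet> (fst (z j) - fst za)))"
    by (intro sum.cong) (auto simp: algebra_simps)
  also have "\<dots> = (\<Sum>j\<in>S. \<alpha> j) * f x' + (\<Sum>j\<in>S. \<alpha> j * (snd (z j) \<bullet> g x'))
      - (\<Sum>j\<in>S. \<alpha> j) * (f (fst za) + y' \<bullet> g (fst za))
      - (\<Sum>j\<in>S. \<alpha> j * (gradL (fst za) y' \<bullet> (fst (z j) - fst za)))"
    by (simp only: sum.distrib sum_subtractf sum_distrib_right)
  also have "\<dots> = f x' + snd za \<bullet> g x' - (f (fst za) + y' \<bullet> g (fst za))"
  proof -
    have "(\<Sum>j\<in>S. \<alpha> j * (gradL (fst za) y' \<bullet> (fst (z j) - fst za))) = 0"
      unfolding fst_za by (rule sum_weighted_diff[OF \<alpha>(2)])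
    moreover have "(\<Sum>j\<in>S. \<alpha> j * (snd (z j) \<bullet> g x')) = snd za \<bullet> g x'"
      by (simp add: snd_za inner_sum_left)
    ultimately show ?thesis by (simp only: \<alpha>(2)) simp
  qed
  finally show ?thesis .
qed

end

theorem theorem7p1:
  fixes f :: "real^'n \<Rightarrow> real" and g :: "real^'n \<Rightarrow> real^'m"
    and L0 :: real and Lg :: "real^'m" and \<sigma> \<theta> :: real
    and z zt :: "nat \<Rightarrow> (real^'n) \<times> (real^'m)" and lam :: "nat \<Rightarrow> real"
    and w :: "nat \<Rightarrow> real^'m" and v :: "nat \<Rightarrow> (real^'n) \<times> (real^'m)" and \<epsilon> :: "nat \<Rightarrow> real"
    and A I :: "nat set" and \<kappa> :: "nat \<Rightarrow> nat"
    and \<tau> :: real and \<Lambda> :: "nat \<Rightarrow> real"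
    and za va :: "nat \<Rightarrow> (real^'n) \<times> (real^'m)" and \<epsilon>a :: "nat \<Rightarrow> real"
    and d0 c \<eta> :: real and i :: nat
  assumes "standing_assumptions f g L0 Lg"
    and "algorithm1 f g L0 Lg \<sigma> \<theta> z zt lam"
    and "\<tau> = tau \<sigma> \<theta>"
    and "w = (\<lambda>k. neg_part (g (fst (zt k)) + inverse (lam k) *\<^sub>R snd (z (k - 1))))"
    and "v = (\<lambda>k. opS f g (zt k) - (0, w k))"
    and "\<epsilon> = (\<lambda>k. snd (zt k) \<bullet> w k)"
    and "A = {k. 1 \<le> k \<and> large_step L0 Lg \<sigma> \<theta> z zt lam k}"
    and "I = {i. 1 \<le> i \<and> (finite A \<longrightarrow> i \<le> card A)}"
    and "\<kappa> = (\<lambda>i. enumerate A (i - 1))"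
    and "\<Lambda> = (\<lambda>i. \<tau> * (\<Sum>j=1..i. lam (\<kappa> j)))"
    and "za = (\<lambda>i. (1 / \<Lambda> i * \<tau>) *\<^sub>R (\<Sum>j=1..i. lam (\<kappa> j) *\<^sub>R zt (\<kappa> j)))"
    and "va = (\<lambda>i. (1 / \<Lambda> i * \<tau>) *\<^sub>R (\<Sum>j=1..i. lam (\<kappa> j) *\<^sub>R v (\<kappa> j)))"
    and "\<epsilon>a = (\<lambda>i. 1 / \<Lambda> i * \<tau> *
           (\<Sum>j=1..i. lam (\<kappa> j) * (\<epsilon> (\<kappa> j) + (zt (\<kappa> j) - za i) \<bullet> (v (\<kappa> j) - va i))))"
    and "d0 = infdist (z 0) (KKT f g)"
    and "c = (L0 + Lg \<bullet> \<bar>snd (z 0)\<bar>) / 2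
           + (1 / 2 + (1 / 2 + 2 * \<sigma> / 3) / sqrt (1 - \<sigma>\<^sup>2)) * d0 * norm Lg"
    and "\<eta> = \<theta>\<^sup>2 / (\<sigma> * c)"
    and "i \<in> I"
  shows
    "(\<exists>j\<in>{1..i}.
        v (\<kappa> j) \<in> eps_subdiff (\<epsilon> (\<kappa> j)) (lagrangian_gap f g (zt (\<kappa> j))) (zt (\<kappa> j)) \<and>
        norm (v (\<kappa> j)) \<le> d0\<^sup>2 / (real i * \<tau> * (1 - \<sigma>) * \<eta>) \<and>
        \<epsilon> (\<kappa> j) \<le> \<sigma>\<^sup>2 * d0 ^ 3 / ((real i * \<tau>) powr (3/2) * (1 - \<sigma>\<^sup>2) powr (3/2) * (2 * \<eta>))) \<and>
     (\<exists>j\<in>{1..i}. \<exists>p q.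
        p = grad f (fst (zt (\<kappa> j))) + gradmat g (fst (zt (\<kappa> j))) *v snd (zt (\<kappa> j)) \<and>
        g (fst (zt (\<kappa> j))) + q \<le> 0 \<and> 0 \<le> snd (zt (\<kappa> j)) \<and>
        snd (zt (\<kappa> j)) \<bullet> (g (fst (zt (\<kappa> j))) + q) = - \<epsilon> (\<kappa> j) \<and>
        norm (p, q) \<le> d0\<^sup>2 / (real i * \<tau> * (1 - \<sigma>) * \<eta>) \<and>
        \<epsilon> (\<kappa> j) \<le> \<sigma>\<^sup>2 * d0 ^ 3 / ((real i * \<tau>) powr (3/2) * (1 - \<sigma>\<^sup>2) powr (3/2) * (2 * \<eta>))) \<and>
     (va i \<in> eps_subdiff (\<epsilon>a i) (lagrangian_gap f g (za i)) (za i) \<and>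
        norm (va i) \<le> 2 * d0\<^sup>2 / ((real i * \<tau>) powr (3/2) * sqrt (1 - \<sigma>\<^sup>2) * \<eta>) \<and>
        \<epsilon>a i \<le> 2 * d0 ^ 3 / ((real i * \<tau>) powr (3/2) * (1 - \<sigma>\<^sup>2) * \<eta>)) \<and>
     (\<exists>p q.
        p \<in> eps_subdiff (\<epsilon>a i + snd (za i) \<bullet> (g (fst (za i)) + q))
              (\<lambda>x. ext_lagrangian f g x (snd (za i))) (fst (za i)) \<and>
        g (fst (za i)) + q \<le> 0 \<and> 0 \<le> snd (za i) \<and>
        snd (za i) \<bullet> (g (fst (za i)) + q) \<ge> - \<epsilon>a i \<and>
        norm (p, q) \<le> 2 * d0\<^sup>2 / ((real i * \<tau>) powr (3/2) * sqrt (1 - \<sigma>\<^sup>2) * \<eta>) \<and>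
        \<epsilon>a i \<le> 2 * d0 ^ 3 / ((real i * \<tau>) powr (3/2) * (1 - \<sigma>\<^sup>2) * \<eta>))"
proof -
  interpret run: algorithm_run f g L0 Lg \<sigma> \<theta> z zt lam
    by unfold_locales (rule assms(1), rule assms(2))
  note \<tau> = assms(3)
  have w: "w = run.w" by (simp add: assms(4) run.w_def fun_eq_iff)
  have v: "v = run.v" by (simp add: assms(5) w run.v_def fun_eq_iff)
  have \<epsilon>: "\<epsilon> = run.\<epsilon>" by (simp add: assms(6) w run.\<epsilon>_def fun_eq_iff)
  have i: "1 \<le> i" "finite A \<longrightarrow> i \<le> card A" using assms(8,17) by auto
  have valid: "finite A \<longrightarrow> j - 1 < card A" if "j \<in> {1..i}" for j
    using that i by auto
  have \<kappa>A: "\<kappa> j \<in> A" if "j \<in> {1..i}" for j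
    using enumerate_valid(1)[OF valid[OF that]] by (simp add: assms(9))
  then have large: "1 \<le> \<kappa> j" "large_step L0 Lg \<sigma> \<theta> z zt lam (\<kappa> j)" if "j \<in> {1..i}" for j
    using that by (auto simp: assms(7))
  \<comment> \<open>Truncated subtraction makes \<open>\<kappa> 0\<close> equal to
    \<open>\<kappa> 1\<close>, so the starting point must be set separately. Since \<open>z\<close>
    stands still outside \<open>A\<close>, dropping those indices leaves a genuine HPE
    sequence.\<close>
  define Z where "Z j = (if j = 0 then z 0 else z (\<kappa> j))" for j
  have Z_prev: "Z (j - 1) = z (\<kappa> j - 1)" if j: "j \<in> {1..i}" for j
  proof -
    have stay: "z k = z (k - 1)" if "1 \<le> k" "k \<notin> A" for k
      using run.run_small(2)[OF that(1)] that by (simp add: assms(7))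
    show ?thesis
    proof (cases "j = 1")
      case True
      have "z (\<kappa> 1 - 1) = z 0"
      proof (rule constant_of_steps)
        fix k assume "0 < k" "k \<le> \<kappa> 1 - 1"
        then show "z k = z (k - 1)"
          using stay[of k] enumerate_valid(4)[OF valid[OF j], of k] True by (auto simp: assms(9))
      qed simp
      then show ?thesis using True by (simp add: Z_def)
    next
      case False
      then have S: "j - 1 = Suc (j - 2)" using j by auto
      have "\<kappa> (j - 1) = enumerate A (j - 2)" by (simp add: assms(9) numeral_2_eq_2)
      note en = enumerate_valid(2,3)[OF valid[OF j] S, folded this]
      have "z (\<kappa> j - 1) = z (\<kappa> (j - 1))"
      proof (rule constant_of_steps)
        show "\<kappa> (j - 1) \<le> \<kappa> j - 1" using en(1) by (simp add: assms(9))
        fix k assume k: "\<kappa> (j - 1) < k" "k \<le> \<kappa> j - 1"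
        then have "k < enumerate A (j - 1)" by (simp add: assms(9))
        then show "z k = z (k - 1)" using stay[of k] en(2)[OF k(1)] k by auto
      qed
      then show ?thesis using False j by (simp add: Z_def)
    qed
  qed
  obtain zs where zs: "zs \<in> KKT f g" "d0 = norm (z 0 - zs)"
    using infdist_attains_inf[OF run.closed_KKT run.KKT_nonempty, of "z 0"]
    by (metis assms(14) dist_norm)
  have hpe: "relaxed_hpe Z (\<lambda>j. zt (\<kappa> j)) (\<lambda>j. v (\<kappa> j)) (\<lambda>j. \<epsilon> (\<kappa> j)) (\<lambda>j. lam (\<kappa> j)) \<sigma> \<tau> d0 zs i"
  proof
    fix j assume j: "j \<in> {1..i}"
    note L = large[OF j]
    show "0 < lam (\<kappa> j)" by (rule run.lam_pos[OF L(1)])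
    show "Z j = Z (j - 1) - (\<tau> * lam (\<kappa> j)) *\<^sub>R v (\<kappa> j)"
      unfolding Z_prev[OF j] \<tau> v using run.z_large[OF L run.lam_pos[OF L(1)]] j
      by (simp add: Z_def)
    show "(norm (lam (\<kappa> j) *\<^sub>R v (\<kappa> j) + zt (\<kappa> j) - Z (j - 1)))\<^sup>2 + 2 * lam (\<kappa> j) * \<epsilon> (\<kappa> j)
        \<le> \<sigma>\<^sup>2 * (norm (zt (\<kappa> j) - Z (j - 1)))\<^sup>2"
      unfolding Z_prev[OF j] v \<epsilon> by (rule run.hpe_error[OF L])
    show "0 \<le> \<epsilon> (\<kappa> j)" unfolding \<epsilon> by (rule run.\<epsilon>_nonneg[OF L(1)])
    show "0 \<le> \<epsilon> (\<kappa> j) + v (\<kappa> j) \<bullet> (zt (\<kappa> j) - zs)"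
      unfolding v \<epsilon> run.v_def run.\<epsilon>_def
      by (rule run.KKT_monotone[OF zs(1) run.yt_nonneg[OF L(1)] run.w_nonneg])
  qed (use run.\<sigma> run.\<tau> \<tau> zs in \<open>auto simp: Z_def\<close>)
  then interpret hpe: relaxed_hpe Z "\<lambda>j. zt (\<kappa> j)" "\<lambda>j. v (\<kappa> j)" "\<lambda>j. \<epsilon> (\<kappa> j)" "\<lambda>j. lam (\<kappa> j)" \<sigma> \<tau> d0 zs i .
  have bound: "\<theta>\<^sup>2 \<le> lam (\<kappa> j) * (\<sigma> * hpe.D j) * c" if j: "j \<in> {1..i}" for j
    using run.large_step_lower_bound[OF large[OF j], of zs d0] zs(2)
      hpe.zt_dist[OF j] hpe.D_bound[OF j]
    unfolding Z_prev[OF j] assms(15) by simp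
  have i1: "1 \<in> {1..i}" using i by simp
  \<comment> \<open>Positivity of \<open>c\<close>, and with it of \<open>\<eta>\<close>, is read
    off from \<open>bound\<close> at the first large step, as \<open>\<theta>\<^sup>2\<close> is
    positive.\<close>
  have "0 < lam (\<kappa> 1) * (\<sigma> * hpe.D 1) * c"
    using bound[OF i1] run.\<theta>(1) by (meson less_le_trans zero_less_power)
  moreover have "0 \<le> lam (\<kappa> 1) * (\<sigma> * hpe.D 1)"
    using hpe.lam_pos[OF i1] run.\<sigma> by (intro mult_nonneg_nonneg) auto
  ultimately have c: "0 < c" by (simp add: zero_less_mult_iff)
  interpret hpe: large_step_hpe Z "\<lambda>j. zt (\<kappa> j)" "\<lambda>j. v (\<kappa> j)" "\<lambda>j. \<epsilon> (\<kappa> j)" "\<lambda>j. lam (\<kappa> j)" \<sigma> \<tau> d0 zs i \<eta>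
  proof
    show "0 < \<eta>" using c run.\<sigma> run.\<theta> by (simp add: assms(16))
    show "\<eta> \<le> lam (\<kappa> j) * hpe.D j" if "j \<in> {1..i}" for j
      using bound[OF that] c run.\<sigma> by (simp add: assms(16) pos_divide_le_eq mult_ac)
  qed (rule i)
  have za: "za i = hpe.zta"
    by (simp only: assms(10,11) hpe.zta_def hpe.Lam_def)
  have va: "va i = hpe.va"
    by (simp only: assms(10,12) hpe.va_def hpe.Lam_def)
  have \<epsilon>a: "\<epsilon>a i = hpe.\<epsilon>a"
    by (simp only: assms(13) za va hpe.\<epsilon>a_def) (simp only: assms(10) hpe.Lam_def)
  have gap: "v (\<kappa> j) \<bullet> ((x', y') - zt (\<kappa> j)) - \<epsilon> (\<kappa> j)
      \<le> f x' + snd (zt (\<kappa> j)) \<bullet> g x' - (f (fst (zt (\<kappa> j))) + y' \<bullet> g (fst (zt (\<kappa> j))))"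
    if "j \<in> {1..i}" "0 \<le> y'" for j x' y'
    unfolding v \<epsilon> run.v_def run.\<epsilon>_def
    by (rule run.saddle_gap[OF run.yt_nonneg[OF large(1)[OF that(1)]] run.w_nonneg that(2)])
  obtain j where j: "j \<in> {1..i}"
    and vj: "norm (v (\<kappa> j)) \<le> d0\<^sup>2 / (real i * \<tau> * (1 - \<sigma>) * \<eta>)"
    and \<epsilon>j: "\<epsilon> (\<kappa> j) \<le> \<sigma>\<^sup>2 * d0 ^ 3 / ((real i * \<tau>) powr (3/2) * (1 - \<sigma>\<^sup>2) powr (3/2) * (2 * \<eta>))"
    using hpe.pointwise by blast
  have yj: "0 \<le> snd (zt (\<kappa> j))" by (rule run.yt_nonneg[OF large(1)[OF j]])
  have a: "v (\<kappa> j) \<in> eps_subdiff (\<epsilon> (\<kappa> j)) (lagrangian_gap f g (zt (\<kappa> j))) (zt (\<kappa> j))"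
    by (rule run.gap_in_eps_subdiff[OF hpe.\<epsilon>_nonneg[OF j] yj gap[OF j]])
  \<comment> \<open>The witnesses for the second pointwise claim are the two components of the same
    \<open>v (\<kappa> j)\<close>: adding \<open>g\<close> to the second leaves
    \<open>- w (\<kappa> j)\<close>.\<close>
  have vj_eq: "v (\<kappa> j) = (grad f (fst (zt (\<kappa> j))) + gradmat g (fst (zt (\<kappa> j))) *v snd (zt (\<kappa> j)),
      - g (fst (zt (\<kappa> j))) - w (\<kappa> j))"
    by (simp add: assms(5) opS_def split_beta)
  have b: "g (fst (zt (\<kappa> j))) + (- g (fst (zt (\<kappa> j))) - w (\<kappa> j)) \<le> 0"
      "snd (zt (\<kappa> j)) \<bullet> (g (fst (zt (\<kappa> j))) + (- g (fst (zt (\<kappa> j))) - w (\<kappa> j))) = - \<epsilon> (\<kappa> j)"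
    using run.w_nonneg[of "\<kappa> j"] by (simp_all add: w \<epsilon> run.\<epsilon>_def)
  have ya: "0 \<le> snd (za i)"
    unfolding za hpe.zta_eq snd_sum
    using hpe.\<alpha>_pos run.yt_nonneg large
    by (intro sum_nonneg) (simp add: scaleR_nonneg_nonneg less_imp_le)
  have gap_a: "va i \<bullet> ((x', y') - za i) - \<epsilon>a i
      \<le> f x' + snd (za i) \<bullet> g x' - (f (fst (za i)) + y' \<bullet> g (fst (za i)))" if "0 \<le> y'" for x' y'
    unfolding za va \<epsilon>a
    by (rule run.ergodic_gap[OF gap less_imp_le[OF hpe.\<alpha>_pos] hpe.sum_\<alpha> hpe.zta_eq hpe.va_eq hpe.\<epsilon>a_eq that])
  \<comment> \<open>Testing the inequality at \<open>za i\<close> itself makes both the inner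
    product and the gap vanish.\<close>
  have "0 \<le> \<epsilon>a i" using gap_a[OF ya, of "fst (za i)"] by simp
  then have c: "va i \<in> eps_subdiff (\<epsilon>a i) (lagrangian_gap f g (za i)) (za i)"
    by (intro run.gap_in_eps_subdiff ya gap_a)
  have d: "fst (va i) \<in> eps_subdiff (\<epsilon>a i + snd (za i) \<bullet> (g (fst (za i)) + snd (va i)))
        (\<lambda>x. ext_lagrangian f g x (snd (za i))) (fst (za i))"
      "g (fst (za i)) + snd (va i) \<le> 0"
      "- \<epsilon>a i \<le> snd (za i) \<bullet> (g (fst (za i)) + snd (va i))"
    by (rule run.gap_splitting[OF ya]; rule gap_a; assumption)+
  note bounds = hpe.norm_va[folded va] hpe.\<epsilon>a_le[folded \<epsilon>a]
  show ?thesis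
  proof (intro conjI)
    show "\<exists>j\<in>{1..i}.
        v (\<kappa> j) \<in> eps_subdiff (\<epsilon> (\<kappa> j)) (lagrangian_gap f g (zt (\<kappa> j))) (zt (\<kappa> j)) \<and>
        norm (v (\<kappa> j)) \<le> d0\<^sup>2 / (real i * \<tau> * (1 - \<sigma>) * \<eta>) \<and>
        \<epsilon> (\<kappa> j) \<le> \<sigma>\<^sup>2 * d0 ^ 3 / ((real i * \<tau>) powr (3/2) * (1 - \<sigma>\<^sup>2) powr (3/2) * (2 * \<eta>))"
      using j a vj \<epsilon>j by blast
    show "\<exists>j\<in>{1..i}. \<exists>p q.
        p = grad f (fst (zt (\<kappa> j))) + gradmat g (fst (zt (\<kappa> j))) *v snd (zt (\<kappa> j)) \<and>
        g (fst (zt (\<kappa> j))) + q \<le> 0 \<and> 0 \<le> snd (zt (\<kappa> j)) \<and>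
        snd (zt (\<kappa> j)) \<bullet> (g (fst (zt (\<kappa> j))) + q) = - \<epsilon> (\<kappa> j) \<and>
        norm (p, q) \<le> d0\<^sup>2 / (real i * \<tau> * (1 - \<sigma>) * \<eta>) \<and>
        \<epsilon> (\<kappa> j) \<le> \<sigma>\<^sup>2 * d0 ^ 3 / ((real i * \<tau>) powr (3/2) * (1 - \<sigma>\<^sup>2) powr (3/2) * (2 * \<eta>))"
      using j b yj vj[unfolded vj_eq] \<epsilon>j by blast
    show "\<exists>p q.
        p \<in> eps_subdiff (\<epsilon>a i + snd (za i) \<bullet> (g (fst (za i)) + q))
              (\<lambda>x. ext_lagrangian f g x (snd (za i))) (fst (za i)) \<and>
        g (fst (za i)) + q \<le> 0 \<and> 0 \<le> snd (za i) \<and>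
        snd (za i) \<bullet> (g (fst (za i)) + q) \<ge> - \<epsilon>a i \<and>
        norm (p, q) \<le> 2 * d0\<^sup>2 / ((real i * \<tau>) powr (3/2) * sqrt (1 - \<sigma>\<^sup>2) * \<eta>) \<and>
        \<epsilon>a i \<le> 2 * d0 ^ 3 / ((real i * \<tau>) powr (3/2) * (1 - \<sigma>\<^sup>2) * \<eta>)"
      using d ya bounds
      by (intro exI[of _ "fst (va i)"] exI[of _ "snd (va i)"] conjI) (simp_all only: prod.collapse)
  qed (rule c bounds)+
qed

end
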